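(* The two-parameter quantum determinant $\det_{r,s}T$ is quasi-central in $Fun(GL_{r,s}(n))$. In fact, $$(\det{}_{r,s}T)\,T=M^{-1}TM\,(\det{}_{r,s}T),$$ where $M=\mathrm{diag}\big((rs)^{n-1},(rs)^{n-2},\ldots,1\big)$ is the diagonal $n\times n$ matrix with $k$-th diagonal entry $(rs)^{n-k}$; this implies that $(\det_{r,s}T)\,t_{ij}=(rs)^{i-j}\,t_{ij}\,(\det_{r,s}T)$ for all $1\le i,j\le n$.
   Context: Let $n\ge 2$ and let $r,s\in\mathbb{C}$ be nonzero with $r\neq s$ and $[k]_{r,s}:=\frac{s^k-r^k}{s-r}\neq 0$ for $1\le k\le n$ (in particular $r+s\neq 0$); put $[n]_{r,s}!=[1]_{r,s}\cdots[n]_{r,s}$. Let $V=\mathbb{C}^n$ with column basis vectors $e^i$, dual row basis vectors $e_i$, and matrix units $e_{ij}$ with $e_{ij}e^k=\delta_{jk}e^i$. Define $R\in End(V\otimes V)$ by $$R=s\sum_{i}e_{ii}\otimes e_{ii}+rs\sum_{i>j}e_{ii}\otimes e_{jj}+\sum_{i<j}e_{ii}\otimes e_{jj}+(s-r)\sum_{i>j}e_{ij}\otimes e_{ji}.$$ $A(R)$ is the unital associative $\mathbb{C}$-algebra generated by $t_{ij}$, $1\le i,j\le n$, with relations $RT_1T_2=T_2T_1R$, where $T=(t_{ij})$ and $T_k$ denotes $\sum_{i,j}t_{ij}\otimes(1^{\otimes(k-1)}\otimes e_{ij}\otimes 1\otimes\cdots\otimes 1)$, i.e. $T$ acting in the $k$-th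 tensor factor of $V$. $Fun(GL_{r,s}(n))$ is the associative algebra generated by $t_{ij},t'_{ij}$ subject to the relations of $A(R)$ for the $t_{ij}$ together with $\sum_k t'_{ik}t_{kj}=\sum_k t_{ik}t'_{kj}=\delta_{ij}\cdot 1$. Let $l(\sigma)$ be the number of inversions of $\sigma\in S_n$, and set $$\langle\varepsilon|=\frac{1}{[n]_{r,s}!}\sum_{\sigma\in S_n}(-s)^{l(\sigma)}e_{\sigma(1)}\otimes\cdots\otimes e_{\sigma(n)},\qquad |\varepsilon\rangle=r^{\frac{n(n-1)}{2}}\sum_{\sigma\in S_n}(-r)^{-l(\sigma)}e^{\sigma(1)}\otimes\cdots\otimes e^{\sigma(n)}.$$ The quantum determinant is $\det_{r,s}T=\langle\varepsilon|T_1\cdots T_n|\varepsilon\rangle\in Fun(GL_{r,s}(n))$. Products such as $(\det_{r,s}T)T$ are matrices obtained by multiplying each entry of $T$ by $\det_{r,s}T$ on the indicated side. "Quasi-central" means commuting with the generators $t_{ij}$ up to the nonzero scalars given in the claim. *)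

theory Defs
  imports
    Complex_Main
    "HOL-Library.Poly_Mapping"
    "HOL-Combinatorics.Permutations"
    "HOL-Algebra.QuotRing"
    "HOL-Algebra.Module"
begin

section \<open>Presented associative algebras\<close>

text \<open>
  The free unital algebra on a set of generators is the algebra of finitely supported functions on
  words, with the convolution product of Poly_Mapping. The wrapper type turns lists
  into an additively written monoid, as Poly_Mapping expects.
\<close>

datatype 'g fword = Fword (letters: "'g list")

instantiation fword :: (type) monoid_add
begin

definition zero_fword :: "'a fword" where "zero_fword = Fword []"

definition plus_fword :: "'a fword \<Rightarrow> 'a fword \<Rightarrow> 'a fword"
  where "plus_fword v w = Fword (letters v @ letters w)"

instance by standard (simp_all add: zero_fword_def plus_fword_def)

end

type_synonym 'g free = "'g fword \<Rightarrow>\<^sub>0 complex"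

definition free_algebra :: "'g set \<Rightarrow> (complex, 'g free) module" where
  "free_algebra G =
     \<lparr>carrier = {p. \<forall>w \<in> Poly_Mapping.keys p. set (letters w) \<subseteq> G},
      monoid.mult = (*), one = 1, ring.zero = 0, add = (+),
      smult = (\<lambda>c p. Poly_Mapping.single 0 c * p)\<rparr>"

definition gen_elem :: "'g \<Rightarrow> 'g free" where
  "gen_elem g = Poly_Mapping.single (Fword [g]) 1"

text \<open>
  The quotient of an algebra by a (two-sided) ideal: the library's quotient ring together with
  the induced scalar multiplication on cosets.
\<close>

definition quot_algebra :: "('k, 'a) module \<Rightarrow> 'a set \<Rightarrow> ('k, 'a set) module" where
  "quot_algebra A I =
     ring.extend (A Quot I) (module.fields (\<lambda>c X. \<Union>x\<in>X. I +>\<^bsub>A\<^esub> (c \<odot>\<^bsub>A\<^esub> x)))"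

text \<open>A ring ideal of a unital algebra is stable under scalars, so \<open>genideal\<close> is also the
  algebra ideal generated by the relators \<open>S\<close>.\<close>

definition presented_algebra :: "'g set \<Rightarrow> 'g free set \<Rightarrow> (complex, 'g free set) module" where
  "presented_algebra G S = quot_algebra (free_algebra G) (Idl\<^bsub>free_algebra G\<^esub> S)"

definition gen_class :: "'g set \<Rightarrow> 'g free set \<Rightarrow> 'g \<Rightarrow> 'g free set" where
  "gen_class G S g = Idl\<^bsub>free_algebra G\<^esub> S +>\<^bsub>free_algebra G\<^esub> gen_elem g"


section \<open>Matrices over an algebra and operators on tensor powers\<close>

text \<open>
  A matrix over \<open>A\<close> with rows and columns indexed by a finite set \<open>J\<close> is a function of
  two indices, of which only the values on \<open>J\<close> matter. An element of
  \<open>A \<otimes> End(V\<^sup>\<otimes>\<^sup>m)\<close> is such a matrix indexed by \<open>tuples n m\<close>, the list \<open>[i1,...,im]\<close>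
  standing for the basis vector \<open>e^{i1} \<otimes> ... \<otimes> e^{im}\<close>; since \<open>e_{ij} e^k = \<delta>_{jk} e^i\<close>,
  the first index of a matrix is the row and the second the column.
\<close>

definition scalar_mat :: "('k, 'a) module \<Rightarrow> ('i \<Rightarrow> 'i \<Rightarrow> 'k) \<Rightarrow> 'i \<Rightarrow> 'i \<Rightarrow> 'a" where
  "scalar_mat A X = (\<lambda>i j. X i j \<odot>\<^bsub>A\<^esub> \<one>\<^bsub>A\<^esub>)"

definition mat_mult ::
    "('k, 'a) module \<Rightarrow> 'i set \<Rightarrow> ('i \<Rightarrow> 'i \<Rightarrow> 'a) \<Rightarrow> ('i \<Rightarrow> 'i \<Rightarrow> 'a) \<Rightarrow> 'i \<Rightarrow> 'i \<Rightarrow> 'a" where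
  "mat_mult A J X Y = (\<lambda>i j. \<Oplus>\<^bsub>A\<^esub>k\<in>J. X i k \<otimes>\<^bsub>A\<^esub> Y k j)"

definition mat_one :: "('k, 'a) module \<Rightarrow> 'i \<Rightarrow> 'i \<Rightarrow> 'a" where
  "mat_one A = (\<lambda>i j. if i = j then \<one>\<^bsub>A\<^esub> else \<zero>\<^bsub>A\<^esub>)"

definition tuples :: "nat \<Rightarrow> nat \<Rightarrow> nat list set" where
  "tuples n m = {xs. length xs = m \<and> set xs \<subseteq> {1..n}}"

text \<open>\<open>leg A T k\<close> is \<open>T_k\<close>; the tensor factors are counted from 1, list positions from 0.\<close>

definition leg ::
    "('k, 'a) module \<Rightarrow> (nat \<Rightarrow> nat \<Rightarrow> 'a) \<Rightarrow> nat \<Rightarrow> nat list \<Rightarrow> nat list \<Rightarrow> 'a" where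
  "leg A T k = (\<lambda>xs ys.
     if \<forall>p < length xs. p \<noteq> k - 1 \<longrightarrow> xs ! p = ys ! p
     then T (xs ! (k - 1)) (ys ! (k - 1)) else \<zero>\<^bsub>A\<^esub>)"

text \<open>\<open>legs_prod A n m T\<close> is \<open>T_1 T_2 ... T_m\<close> acting on the \<open>m\<close>-fold tensor power of \<open>\<complex>^n\<close>.\<close>

definition legs_prod ::
    "('k, 'a) module \<Rightarrow> nat \<Rightarrow> nat \<Rightarrow> (nat \<Rightarrow> nat \<Rightarrow> 'a) \<Rightarrow> nat list \<Rightarrow> nat list \<Rightarrow> 'a" where
  "legs_prod A n m T = foldr (\<lambda>k. mat_mult A (tuples n m) (leg A T k)) [1..<m+1] (mat_one A)"

definition mat_unit :: "nat \<Rightarrow> nat \<Rightarrow> nat \<Rightarrow> nat \<Rightarrow> complex" where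
  "mat_unit i j = (\<lambda>a b. if a = i \<and> b = j then 1 else 0)"

definition tensor2 ::
    "(nat \<Rightarrow> nat \<Rightarrow> complex) \<Rightarrow> (nat \<Rightarrow> nat \<Rightarrow> complex) \<Rightarrow> nat list \<Rightarrow> nat list \<Rightarrow> complex" where
  "tensor2 X Y = (\<lambda>xs ys. X (xs ! 0) (ys ! 0) * Y (xs ! 1) (ys ! 1))"

text \<open>The inverse of a complex matrix indexed by \<open>J\<close>, normalised to vanish outside \<open>J\<close>.\<close>

definition mat_inv :: "'i set \<Rightarrow> ('i \<Rightarrow> 'i \<Rightarrow> complex) \<Rightarrow> 'i \<Rightarrow> 'i \<Rightarrow> complex" where
  "mat_inv J X = (THE Y.
     (\<forall>i j. i \<notin> J \<or> j \<notin> J \<longrightarrow> Y i j = 0) \<and>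
     (\<forall>i\<in>J. \<forall>j\<in>J. (\<Sum>k\<in>J. X i k * Y k j) = (if i = j then 1 else 0)) \<and>
     (\<forall>i\<in>J. \<forall>j\<in>J. (\<Sum>k\<in>J. Y i k * X k j) = (if i = j then 1 else 0)))"


section \<open>The algebra \<open>Fun(GL_{r,s}(n))\<close>\<close>

definition rs_int :: "complex \<Rightarrow> complex \<Rightarrow> nat \<Rightarrow> complex" where
  "rs_int r s k = (s ^ k - r ^ k) / (s - r)"

definition rs_fact :: "complex \<Rightarrow> complex \<Rightarrow> nat \<Rightarrow> complex" where
  "rs_fact r s n = (\<Prod>k\<in>{1..n}. rs_int r s k)"

definition R_mat :: "nat \<Rightarrow> complex \<Rightarrow> complex \<Rightarrow> nat list \<Rightarrow> nat list \<Rightarrow> complex" where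
  "R_mat n r s = (\<lambda>xs ys.
       s * (\<Sum>i\<in>{1..n}. tensor2 (mat_unit i i) (mat_unit i i) xs ys)
     + r * s * (\<Sum>i\<in>{1..n}. \<Sum>j\<in>{j\<in>{1..n}. i > j}. tensor2 (mat_unit i i) (mat_unit j j) xs ys)
     + (\<Sum>i\<in>{1..n}. \<Sum>j\<in>{j\<in>{1..n}. i < j}. tensor2 (mat_unit i i) (mat_unit j j) xs ys)
     + (s - r) * (\<Sum>i\<in>{1..n}. \<Sum>j\<in>{j\<in>{1..n}. i > j}. tensor2 (mat_unit i j) (mat_unit j i) xs ys))"

text \<open>\<open>GenT i j\<close> is the letter \<open>t_{ij}\<close> and \<open>GenT' i j\<close> is \<open>t'_{ij}\<close>.\<close>

datatype gl_gen = GenT nat nat | GenT' nat nat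

definition gl_gens :: "nat \<Rightarrow> gl_gen set" where
  "gl_gens n = (\<Union>i\<in>{1..n}. \<Union>j\<in>{1..n}. {GenT i j, GenT' i j})"

definition RTT_relators :: "nat \<Rightarrow> complex \<Rightarrow> complex \<Rightarrow> gl_gen free set" where
  "RTT_relators n r s =
     (let A = free_algebra (gl_gens n);
          J = tuples n 2;
          T = (\<lambda>i j. gen_elem (GenT i j));
          R = scalar_mat A (R_mat n r s)
      in {mat_mult A J R (mat_mult A J (leg A T 1) (leg A T 2)) xs ys
            - mat_mult A J (mat_mult A J (leg A T 2) (leg A T 1)) R xs ys
          | xs ys. xs \<in> J \<and> ys \<in> J})"

definition inverse_relators :: "nat \<Rightarrow> gl_gen free set" where
  "inverse_relators n =
     (let A = free_algebra (gl_gens n);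
          T = (\<lambda>i j. gen_elem (GenT i j));
          T' = (\<lambda>i j. gen_elem (GenT' i j))
      in {mat_mult A {1..n} T' T i j - mat_one A i j | i j. i \<in> {1..n} \<and> j \<in> {1..n}}
       \<union> {mat_mult A {1..n} T T' i j - mat_one A i j | i j. i \<in> {1..n} \<and> j \<in> {1..n}})"

definition gl_relators :: "nat \<Rightarrow> complex \<Rightarrow> complex \<Rightarrow> gl_gen free set" where
  "gl_relators n r s = RTT_relators n r s \<union> inverse_relators n"

definition Fun_GL :: "nat \<Rightarrow> complex \<Rightarrow> complex \<Rightarrow> (complex, gl_gen free set) module" where
  "Fun_GL n r s = presented_algebra (gl_gens n) (gl_relators n r s)"

definition T_mat :: "nat \<Rightarrow> complex \<Rightarrow> complex \<Rightarrow> nat \<Rightarrow> nat \<Rightarrow> gl_gen free set" where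
  "T_mat n r s = (\<lambda>i j. gen_class (gl_gens n) (gl_relators n r s) (GenT i j))"


section \<open>The quantum determinant\<close>

definition inv_count :: "nat \<Rightarrow> (nat \<Rightarrow> nat) \<Rightarrow> nat" where
  "inv_count n \<sigma> = card {(i, j). i \<in> {1..n} \<and> j \<in> {1..n} \<and> i < j \<and> \<sigma> i > \<sigma> j}"

text \<open>The tuple \<open>[\<sigma>(1),...,\<sigma>(n)]\<close>, i.e. \<open>e^{\<sigma>(1)} \<otimes> ... \<otimes> e^{\<sigma>(n)}\<close> or its dual.\<close>

definition perm_tuple :: "nat \<Rightarrow> (nat \<Rightarrow> nat) \<Rightarrow> nat list" where
  "perm_tuple n \<sigma> = map \<sigma> [1..<n+1]"

text \<open>The row vector \<open>\<langle>\<epsilon>|\<close> and the column vector \<open>|\<epsilon>\<rangle>\<close>, by their coordinates.\<close>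

definition eps_bra :: "nat \<Rightarrow> complex \<Rightarrow> complex \<Rightarrow> nat list \<Rightarrow> complex" where
  "eps_bra n r s = (\<lambda>xs. 1 / rs_fact r s n *
     (\<Sum>\<sigma> | \<sigma> permutes {1..n}. (- s) ^ inv_count n \<sigma> * (if xs = perm_tuple n \<sigma> then 1 else 0)))"

definition eps_ket :: "nat \<Rightarrow> complex \<Rightarrow> nat list \<Rightarrow> complex" where
  "eps_ket n r = (\<lambda>xs. r ^ (n * (n - 1) div 2) *
     (\<Sum>\<sigma> | \<sigma> permutes {1..n}.
        (- r) powi (- int (inv_count n \<sigma>)) * (if xs = perm_tuple n \<sigma> then 1 else 0)))"

definition qdet :: "nat \<Rightarrow> complex \<Rightarrow> complex \<Rightarrow> gl_gen free set" where
  "qdet n r s =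
     (let A = Fun_GL n r s
      in \<Oplus>\<^bsub>A\<^esub>xs\<in>tuples n n. \<Oplus>\<^bsub>A\<^esub>ys\<in>tuples n n.
           (eps_bra n r s xs * eps_ket n r ys) \<odot>\<^bsub>A\<^esub> legs_prod A n n (T_mat n r s) xs ys)"

definition M_mat :: "nat \<Rightarrow> complex \<Rightarrow> complex \<Rightarrow> nat \<Rightarrow> nat \<Rightarrow> complex" where
  "M_mat n r s = (\<lambda>k l. if k = l then (r * s) ^ (n - k) else 0)"

definition quasi_central :: "(complex, 'a) module \<Rightarrow> 'a set \<Rightarrow> 'a \<Rightarrow> bool" where
  "quasi_central A S d \<longleftrightarrow>
     (\<forall>x\<in>S. \<exists>c. c \<noteq> 0 \<and> d \<otimes>\<^bsub>A\<^esub> x = c \<odot>\<^bsub>A\<^esub> (x \<otimes>\<^bsub>A\<^esub> d))"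


section \<open>Well-definedness checks\<close>

lemma ring_free_algebra: "ring (free_algebra G)"
proof (rule ringI)
  show "abelian_group (free_algebra G)"
  proof (rule abelian_groupI)
    fix x assume "x \<in> carrier (free_algebra G)"
    then show "\<exists>y\<in>carrier (free_algebra G). y \<oplus>\<^bsub>free_algebra G\<^esub> x = \<zero>\<^bsub>free_algebra G\<^esub>"
      by (intro bexI[of _ "- x"]) (auto simp: free_algebra_def)
  qed (use keys_add in \<open>fastforce simp: free_algebra_def algebra_simps\<close>)+
  show "monoid (free_algebra G)"
  proof (rule monoidI)
    fix x y assume "x \<in> carrier (free_algebra G)" "y \<in> carrier (free_algebra G)"
    then show "x \<otimes>\<^bsub>free_algebra G\<^esub> y \<in> carrier (free_algebra G)"
      using keys_mult[of x y] by (fastforce simp: free_algebra_def plus_fword_def)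
  qed (auto simp: free_algebra_def zero_fword_def algebra_simps)
qed (auto simp: free_algebra_def algebra_simps)

lemma mat_inv_diag:
  assumes "finite J" "\<And>k. k \<in> J \<Longrightarrow> d k \<noteq> 0"
  shows "mat_inv J (\<lambda>k l. if k = l then d k else 0)
       = (\<lambda>k l. if k \<in> J \<and> k = l then inverse (d k) else 0)"
  unfolding mat_inv_def
proof (rule the_equality)
  show "(\<forall>i j. i \<notin> J \<or> j \<notin> J \<longrightarrow> (if i \<in> J \<and> i = j then inverse (d i) else 0) = 0) \<and>
    (\<forall>i\<in>J. \<forall>j\<in>J. (\<Sum>k\<in>J. (if i = k then d i else 0) * (if k \<in> J \<and> k = j then inverse (d k) else 0))
       = (if i = j then 1 else 0)) \<and>
    (\<forall>i\<in>J. \<forall>j\<in>J. (\<Sum>k\<in>J. (if i \<in> J \<and> i = k then inverse (d i) else 0) * (if k = j then d k else 0))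
       = (if i = j then 1 else 0))"
    using assms by (auto simp: if_distrib[of "\<lambda>x. x * _"] sum.delta cong: if_cong)
next
  fix Y
  assume Y: "(\<forall>i j. i \<notin> J \<or> j \<notin> J \<longrightarrow> Y i j = 0) \<and>
    (\<forall>i\<in>J. \<forall>j\<in>J. (\<Sum>k\<in>J. (if i = k then d i else 0) * Y k j) = (if i = j then 1 else 0)) \<and>
    (\<forall>i\<in>J. \<forall>j\<in>J. (\<Sum>k\<in>J. Y i k * (if k = j then d k else 0)) = (if i = j then 1 else 0))"
  show "Y = (\<lambda>k l. if k \<in> J \<and> k = l then inverse (d k) else 0)"
  proof (intro ext)
    fix k l
    show "Y k l = (if k \<in> J \<and> k = l then inverse (d k) else 0)"
    proof (cases "k \<in> J \<and> l \<in> J")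
      case True
      then have "d k * Y k l = (if k = l then 1 else 0)"
        using Y assms(1) by (auto simp: if_distrib[of "\<lambda>x. x * _"] sum.delta cong: if_cong)
      then show ?thesis using True assms(2)[of k] by (auto simp: field_simps split: if_splits)
    qed (use Y in auto)
  qed
qed

lemma free_algebra_diff:
  assumes "p \<in> carrier (free_algebra G)" "q \<in> carrier (free_algebra G)"
  shows "p - q \<in> carrier (free_algebra G)"
  using assms keys_diff[of p q] by (fastforce simp: free_algebra_def)

lemma free_algebra_smult:
  assumes "p \<in> carrier (free_algebra G)"
  shows "c \<odot>\<^bsub>free_algebra G\<^esub> p \<in> carrier (free_algebra G)"
  using assms keys_mult[of "Poly_Mapping.single 0 c" p]
  by (fastforce simp: free_algebra_def plus_fword_def zero_fword_def split: if_splits)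

lemma gl_relators_closed: "gl_relators n r s \<subseteq> carrier (free_algebra (gl_gens n))"
proof -
  interpret A: ring "free_algebra (gl_gens n)" by (rule ring_free_algebra)
  have [simp]: "gen_elem (GenT i j) \<in> carrier (free_algebra (gl_gens n))"
    "gen_elem (GenT' i j) \<in> carrier (free_algebra (gl_gens n))"
    if "i \<in> {1..n}" "j \<in> {1..n}" for i j
    using that by (auto simp: free_algebra_def gen_elem_def gl_gens_def)
  have [simp]: "scalar_mat (free_algebra (gl_gens n)) X i j \<in> carrier (free_algebra (gl_gens n))"
    for X and i j :: "nat list"
    by (simp add: scalar_mat_def free_algebra_smult)
  have nth: "xs ! k \<in> {1..n}" if "xs \<in> tuples n 2" "k < 2" for xs k
    using that nth_mem[of k xs] unfolding tuples_def by (metis (mono_tags, lifting) mem_Collect_eq subsetD)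
  have [simp]: "leg (free_algebra (gl_gens n)) (\<lambda>i j. gen_elem (GenT i j)) k xs ys
      \<in> carrier (free_algebra (gl_gens n))"
    if "xs \<in> tuples n 2" "ys \<in> tuples n 2" "k = Suc 0 \<or> k = 2" for xs ys k
    using that nth[of xs "k - 1"] nth[of ys "k - 1"] by (auto simp: leg_def)
  show ?thesis
    unfolding gl_relators_def RTT_relators_def inverse_relators_def Let_def
    by (auto intro!: free_algebra_diff A.finsum_closed A.m_closed simp: mat_mult_def mat_one_def)
qed

lemma ideal_gl_relators:
  "ideal (Idl\<^bsub>free_algebra (gl_gens n)\<^esub> gl_relators n r s) (free_algebra (gl_gens n))"
  by (intro ring.genideal_ideal ring_free_algebra gl_relators_closed)

lemma ring_extend:
  assumes "ring R"
  shows "ring (ring.extend R m)"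
proof -
  interpret ring R by (rule assms)
  have neg: "\<exists>y\<in>carrier R. y \<oplus>\<^bsub>R\<^esub> x = \<zero>\<^bsub>R\<^esub>" if "x \<in> carrier R" for x
    using that by (intro bexI[of _ "\<ominus>\<^bsub>R\<^esub> x"]) (auto simp: l_neg)
  show ?thesis
    by (intro ringI abelian_groupI monoidI)
      (simp_all add: ring.defs add.m_ac m_assoc l_distr r_distr neg)
qed

lemma ring_Fun_GL: "ring (Fun_GL n r s)"
  unfolding Fun_GL_def presented_algebra_def quot_algebra_def
  by (intro ring_extend ideal.quotient_is_ring ideal_gl_relators)

lemma smult_coset:
  assumes "ideal I (free_algebra G)" "p \<in> carrier (free_algebra G)"
  shows "c \<odot>\<^bsub>quot_algebra (free_algebra G) I\<^esub> (I +>\<^bsub>free_algebra G\<^esub> p)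
       = I +>\<^bsub>free_algebra G\<^esub> (c \<odot>\<^bsub>free_algebra G\<^esub> p)"
proof -
  interpret I: ideal I "free_algebra G" by (rule assms(1))
  let ?A = "free_algebra G"
  have 1: "I +>\<^bsub>?A\<^esub> (c \<odot>\<^bsub>?A\<^esub> x) = I +>\<^bsub>?A\<^esub> (c \<odot>\<^bsub>?A\<^esub> p)" if x: "x \<in> I +>\<^bsub>?A\<^esub> p" for x
  proof -
    from x obtain h where h: "h \<in> I" "x = h \<oplus>\<^bsub>?A\<^esub> p"
      by (auto simp: a_r_coset_def r_coset_def)
    have "Poly_Mapping.single 0 c \<otimes>\<^bsub>?A\<^esub> h \<in> I"
      by (rule I.I_l_closed[OF h(1)]) (auto simp: free_algebra_def zero_fword_def)
    then have ch: "c \<odot>\<^bsub>?A\<^esub> h \<in> I" by (simp add: free_algebra_def)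
    have "c \<odot>\<^bsub>?A\<^esub> x = c \<odot>\<^bsub>?A\<^esub> h \<oplus>\<^bsub>?A\<^esub> c \<odot>\<^bsub>?A\<^esub> p"
      using h by (simp add: free_algebra_def algebra_simps)
    then have "c \<odot>\<^bsub>?A\<^esub> x \<in> I +>\<^bsub>?A\<^esub> (c \<odot>\<^bsub>?A\<^esub> p)"
      using ch by (auto simp: a_r_coset_def r_coset_def)
    then show ?thesis
      using I.a_repr_independence'[OF _ free_algebra_smult[OF assms(2)]] by simp
  qed
  have self: "p \<in> I +>\<^bsub>?A\<^esub> p" by (rule I.a_rcos_self[OF assms(2)])
  have "(\<Union>x\<in>I +>\<^bsub>?A\<^esub> p. I +>\<^bsub>?A\<^esub> (c \<odot>\<^bsub>?A\<^esub> x)) = I +>\<^bsub>?A\<^esub> (c \<odot>\<^bsub>?A\<^esub> p)"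
  proof (rule SUP_eq_const)
    show "I +>\<^bsub>?A\<^esub> p \<noteq> {}" using self by (metis empty_iff)
  qed (rule 1)
  then show ?thesis
    by (simp add: quot_algebra_def ring.defs module.defs)
qed

end

theory Submission
  imports Defs "HOL-Algebra.UnivPoly"
begin

text \<open>
  Let \<open>P\<close> be the flip. The RTT relation says that \<open>P R\<close>, acting in two adjacent tensor factors,
  commutes with \<open>T_1 ... T_m\<close>. The operators \<open>P R\<close> on row vectors satisfy the braid relations, and
  \<open>\<langle>\<epsilon>|\<close> is, up to a factor, their only common eigenvector with eigenvalue \<open>- r\<close> in the \<open>n\<close>-fold
  tensor power (\<open>braid_op_skew\<close>, \<open>eigenvector_eq_skew\<close>; the uniqueness uses \<open>r + s \<noteq> 0\<close>).

  Consider the row vector \<open>\<langle>\<epsilon>| \<otimes> e_k\<close> in \<open>n + 1\<close> factors, and carry its last factor to the front by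
  \<open>n\<close> successive operators. By the braid relations the result is skew in the last \<open>n\<close> factors,
  hence determined by its coefficients at sorted words, and these can be read off:
  the result is \<open>s (rs)^(k-1) e_k \<otimes> \<langle>\<epsilon>|\<close>. The same computation applies to
  \<open>(\<langle>\<epsilon>| \<otimes> e_k) T_1 ... T_(n+1)\<close>, which is skew in its first \<open>n\<close> factors too; it gives the
  factor \<open>s (rs)^(l-1)\<close> at the column \<open>l\<close> of the last factor. As the operators commute with
  \<open>T_1 ... T_(n+1)\<close>, both results agree, so for every column multi-index
  \<open>(rs)^(l-1) (\<langle>\<epsilon>| T_1 ... T_n) t_{kl} = (rs)^(k-1) t_{kl} (\<langle>\<epsilon>| T_1 ... T_n)\<close>
  (\<open>skew_contraction_commutes\<close>). Pairing with \<open>|\<epsilon>\<rangle>\<close> gives the claim, and conjugation by \<open>M\<close>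
  produces the same scalar \<open>(rs)^(k-l)\<close>.

  All of this is done with complex numbers: an element of the free algebra lies in the defining ideal
  if every linear functional that vanishes on the ideal kills it
  (\<open>mem_ideal_by_functionals\<close>), so the entries of \<open>T_1 ... T_m\<close> may be replaced by their values under such
  a functional. The rest is the translation between the quotient algebra and monomials of
  the free algebra.
\<close>

section \<open>The braid operators\<close>

text \<open>
  The diagonal coefficient of \<open>R\<close> at \<open>e^a \<otimes> e^b\<close>.
\<close>

definition exch_wt :: "complex \<Rightarrow> complex \<Rightarrow> nat \<Rightarrow> nat \<Rightarrow> complex" where
  "exch_wt r s a b = (if a = b then s else if b < a then r * s else 1)"

text \<open>
  A function on words is a row vector of a tensor power of \<open>V\<close>. With \<open>P\<close> the flip, this is
  right multiplication by \<open>P R\<close> in the factors at list positions \<open>i\<close> and \<open>i + 1\<close>. Words too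
  short for these positions are sent to \<open>0\<close>, which makes the relations below equalities of
  functions on all words.
\<close>

definition braid_op ::
    "complex \<Rightarrow> complex \<Rightarrow> nat \<Rightarrow> (nat list \<Rightarrow> complex) \<Rightarrow> nat list \<Rightarrow> complex" where
  "braid_op r s i g xs =
     (if Suc i < length xs
      then exch_wt r s (xs ! i) (xs ! Suc i) * g (xs[i := xs ! Suc i, Suc i := xs ! i])
         + (if xs ! i < xs ! Suc i then (s - r) * g xs else 0)
      else 0)"

lemma split_at_adjacent:
  assumes "Suc i < length xs"
  obtains u a b v where "xs = u @ a # b # v" "length u = i"
proof
  show "xs = take i xs @ xs ! i # xs ! Suc i # drop (Suc (Suc i)) xs"
    using assms by (metis Cons_nth_drop_Suc Suc_lessD append_take_drop_id)
  show "length (take i xs) = i" using assms by simp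
qed

lemma braid_op_split:
  assumes "length u = i"
  shows "braid_op r s i g (u @ a # b # v) =
     exch_wt r s a b * g (u @ b # a # v) + (if a < b then (s - r) * g (u @ a # b # v) else 0)"
  using assms by (auto simp: braid_op_def nth_append list_update_append)

text \<open>
  This is the Yang-Baxter equation for \<open>R\<close>. Only the relative order of the three letters
  involved enters the coefficients, so it is a finite check.
\<close>

lemma braid_relation:
  "braid_op r s i (braid_op r s (Suc i) (braid_op r s i g)) =
   braid_op r s (Suc i) (braid_op r s i (braid_op r s (Suc i) g))"
proof
  fix xs
  show "braid_op r s i (braid_op r s (Suc i) (braid_op r s i g)) xs =
    braid_op r s (Suc i) (braid_op r s i (braid_op r s (Suc i) g)) xs"
  proof (cases "Suc (Suc i) < length xs")
    case True
    then obtain u' b c v where xs': "xs = u' @ b # c # v" and len: "length u' = Suc i"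
      by (rule split_at_adjacent)
    then obtain u a where "u' = u @ [a]" "length u = i"
      by (metis length_Suc_conv_rev)
    with xs' have xs: "xs = u @ a # b # c # v" and u: "length u = i" by simp_all
    have 0: "braid_op r s i h (u @ a # b # z) =
      exch_wt r s a b * h (u @ b # a # z) + (if a < b then (s - r) * h (u @ a # b # z) else 0)"
      for h a b z by (rule braid_op_split[OF u])
    have 1: "braid_op r s (Suc i) h (u @ c # a # b # z) =
      exch_wt r s a b * h (u @ c # b # a # z) + (if a < b then (s - r) * h (u @ c # a # b # z) else 0)"
      for h a b c z using braid_op_split[of "u @ [c]" "Suc i" r s h a b z] u by simp
    show ?thesis
      unfolding xs 0 1
      by (cases a b rule: linorder_cases; cases b c rule: linorder_cases; cases a c rule: linorder_cases)
        (simp_all add: exch_wt_def algebra_simps)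
  next
    case False
    then show ?thesis by (simp add: braid_op_def)
  qed
qed

lemma braid_op_commute_distant:
  assumes "Suc i < j"
  shows "braid_op r s i (braid_op r s j g) = braid_op r s j (braid_op r s i g)"
proof
  fix xs
  show "braid_op r s i (braid_op r s j g) xs = braid_op r s j (braid_op r s i g) xs"
  proof (cases "Suc j < length xs")
    case True
    then obtain u' c d w where xs': "xs = u' @ c # d # w" and len: "length u' = j"
      by (rule split_at_adjacent)
    then have "Suc i < length u'" using assms by simp
    then obtain u a b v where u': "u' = u @ a # b # v" and u: "length u = i"
      by (rule split_at_adjacent)
    have xs: "xs = u @ a # b # v @ c # d # w" using xs' u' by simp
    have 0: "braid_op r s i h (u @ a # b # z) =
      exch_wt r s a b * h (u @ b # a # z) + (if a < b then (s - r) * h (u @ a # b # z) else 0)"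
      for h a b z by (rule braid_op_split[OF u])
    have 1: "braid_op r s j h (u @ a # b # v @ c # d # z) =
      exch_wt r s c d * h (u @ a # b # v @ d # c # z)
      + (if c < d then (s - r) * h (u @ a # b # v @ c # d # z) else 0)"
      for h a b c d z using braid_op_split[of "u @ a # b # v" j r s h c d z] u u' len by simp
    show ?thesis
      unfolding xs 0 1 by (simp add: algebra_simps)
  next
    case False
    then show ?thesis by (simp add: braid_op_def)
  qed
qed

lemma braid_op_scale: "braid_op r s i (\<lambda>xs. c * g xs) = (\<lambda>xs. c * braid_op r s i g xs)"
  by (auto simp: braid_op_def algebra_simps)

text \<open>
  The operators at positions \<open>j - 1\<close>, ..., \<open>i\<close>, applied in this order: the letter at position
  \<open>j\<close> is carried to the left until it stands at position \<open>i\<close>.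
\<close>

abbreviation braid_chain where
  "braid_chain r s i j g \<equiv> foldr (braid_op r s) [i..<j] g"

lemma braid_chain_scale:
  "braid_chain r s i j (\<lambda>xs. c * g xs) = (\<lambda>xs. c * braid_chain r s i j g xs)"
proof -
  have "foldr (braid_op r s) is (\<lambda>xs. c * g xs) = (\<lambda>xs. c * foldr (braid_op r s) is g xs)" for "is"
    by (induction "is") (simp_all add: braid_op_scale)
  then show ?thesis .
qed

lemma braid_chain_commute_distant:
  "j \<le> i \<Longrightarrow> braid_op r s (Suc i) (braid_chain r s 0 j g) = braid_chain r s 0 j (braid_op r s (Suc i) g)"
  by (induction j arbitrary: g) (simp_all add: braid_op_commute_distant[of _ "Suc i"])

text \<open>
  Carrying a letter to the front moves everything it passes one place to the right, and hence
  an operator acting there as well. One braid relation does this at the crossing; all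
  other factors of the chain act far away.
\<close>

lemma braid_chain_shift:
  "Suc i < m \<Longrightarrow> braid_op r s (Suc i) (braid_chain r s 0 m g) = braid_chain r s 0 m (braid_op r s i g)"
proof (induction m arbitrary: g)
  case (Suc m)
  show ?case
  proof (cases "Suc i = m")
    case True
    have "braid_op r s (Suc i) (braid_chain r s 0 (Suc (Suc i)) g)
      = braid_chain r s 0 i (braid_op r s (Suc i) (braid_op r s i (braid_op r s (Suc i) g)))"
      by (simp add: braid_chain_commute_distant)
    also have "\<dots> = braid_chain r s 0 (Suc (Suc i)) (braid_op r s i g)"
      by (simp add: braid_relation)
    finally show ?thesis using True by simp
  next
    case False
    then have "Suc i < m" using Suc.prems by simp
    then show ?thesis using Suc.IH by (simp add: braid_op_commute_distant[of i m])
  qed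
qed simp

section \<open>Skew-symmetric row vectors\<close>

fun inversions :: "nat list \<Rightarrow> nat" where
  "inversions [] = 0"
| "inversions (x # xs) = length (filter (\<lambda>y. y < x) xs) + inversions xs"

lemma inversions_swap:
  "b < a \<Longrightarrow> inversions (u @ a # b # v) = Suc (inversions (u @ b # a # v))"
  by (induction u) auto

text \<open>
  The coordinates of \<open>\<langle>\<epsilon>|\<close> up to the factor \<open>1/[n]!\<close>, extended to words of any length.
\<close>

definition skew :: "complex \<Rightarrow> nat list \<Rightarrow> complex" where
  "skew s xs = (if distinct xs then (- s) ^ inversions xs else 0)"

lemma skew_swap: "b < a \<Longrightarrow> skew s (u @ a # b # v) = - s * skew s (u @ b # a # v)"
  using inversions_swap[of b a u v] by (simp add: skew_def disj_commute conj_commute insert_commute)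

lemma skew_repeat: "skew s (u @ a # a # v) = 0"
  by (simp add: skew_def)

text \<open>
  On the span of \<open>e_a \<otimes> e_b\<close> and \<open>e_b \<otimes> e_a\<close> with \<open>a < b\<close> the operator has the eigenvector
  \<open>e_a \<otimes> e_b - s e_b \<otimes> e_a\<close> for the eigenvalue \<open>- r\<close>.
\<close>

lemma braid_op_skew:
  assumes "Suc i < length xs"
  shows "braid_op r s i (skew s) xs = - r * skew s xs"
proof -
  obtain u a b v where xs: "xs = u @ a # b # v" "length u = i"
    using assms by (rule split_at_adjacent)
  show ?thesis
  proof (cases a b rule: linorder_cases)
    case less
    then show ?thesis
      unfolding xs(1) braid_op_split[OF xs(2)]
      using skew_swap[of a b s u v] by (simp add: exch_wt_def algebra_simps)
  next
    case equal
    then show ?thesis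
      unfolding xs(1) braid_op_split[OF xs(2)] by (simp add: exch_wt_def skew_repeat)
  next
    case greater
    then show ?thesis
      unfolding xs(1) braid_op_split[OF xs(2)]
      using skew_swap[of b a s u v] by (simp add: exch_wt_def algebra_simps)
  qed
qed

lemma skew_upt: "skew s [i..<j] = 1"
proof -
  have "inversions xs = 0" if "sorted xs" for xs
    using that by (induction xs) (auto simp: filter_empty_conv)
  then show ?thesis by (simp add: skew_def)
qed

text \<open>
  An eigenvector for \<open>- r\<close> at every position is unique up to a factor. The eigenvalue equation
  kills words with two equal neighbours, as \<open>r + s \<noteq> 0\<close>, and removes a descent at the price of a
  factor \<open>- s\<close>; so any word can be sorted, and sorting exposes a repeated letter if there is one.
\<close>

lemma eigenvector_eq_skew:
  assumes "r \<noteq> 0" "r + s \<noteq> 0"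
    and eig: "\<And>i xs. xs \<in> tuples n n \<Longrightarrow> Suc i < n \<Longrightarrow> braid_op r s i g xs = - r * g xs"
    and "xs \<in> tuples n n"
  shows "g xs = skew s xs * g [1..<n + 1]"
  using assms(4)
proof (induction "inversions xs" arbitrary: xs rule: less_induct)
  case less
  have len: "length xs = n" and sub: "set xs \<subseteq> {1..n}" using less.prems by (auto simp: tuples_def)
  have eigs: "exch_wt r s a b * g (u @ b # a # v) + (if a < b then (s - r) * g (u @ a # b # v) else 0)
      = - r * g (u @ a # b # v)"
    if "xs = u @ a # b # v" for u a b v
    using eig[OF less.prems, of "length u"] that len braid_op_split[OF refl, of r s u g a b v] by simp
  show ?case
  proof (cases "sorted_wrt (<) xs")
    case True
    then have "distinct xs" "sorted xs"
      by (simp_all add: strict_sorted_iff)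
    moreover from this have "set xs = {1..n}"
      using sub len by (simp add: card_subset_eq distinct_card)
    moreover have "sorted [1..<n+1]" "distinct [1..<n+1]" "set [1..<n+1] = {1..n}"
      by (auto simp del: upt_Suc)
    ultimately have "xs = [1..<n+1]" by (intro sorted_distinct_set_unique) auto
    then show ?thesis by (simp add: skew_upt del: upt_Suc)
  next
    case False
    then obtain i where i: "Suc i < length xs" "xs ! Suc i \<le> xs ! i"
      by (auto simp: sorted_wrt_iff_nth_Suc_transp[OF transp_on_less] not_less)
    from this(1) obtain u a b v where xs: "xs = u @ a # b # v" "length u = i"
      by (rule split_at_adjacent)
    then have "b \<le> a" using i by (simp add: nth_append)
    show ?thesis
    proof (cases "a = b")
      case True
      then have "(r + s) * g xs = 0"
        using eigs[OF xs(1)] xs(1) by (simp add: exch_wt_def algebra_simps)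
      then show ?thesis using True assms(2) xs(1) by (simp add: skew_repeat)
    next
      case False
      with \<open>b \<le> a\<close> have "b < a" by simp
      then have "r * g xs = r * (- s * g (u @ b # a # v))"
        using eigs[OF xs(1)] xs(1) by (simp add: exch_wt_def algebra_simps)
      then have "g xs = - s * g (u @ b # a # v)" using assms(1) by (metis mult_left_cancel)
      also have "g (u @ b # a # v) = skew s (u @ b # a # v) * g [1..<n + 1]"
        using less.hyps[of "u @ b # a # v"] less.prems \<open>b < a\<close>
        by (auto simp: xs(1) inversions_swap[OF \<open>b < a\<close>] tuples_def)
      finally show ?thesis using skew_swap[OF \<open>b < a\<close>] by (simp add: xs(1))
    qed
  qed
qed

section \<open>Carrying a letter across a word\<close>

lemma braid_chain_Cons:
  assumes "length u = i"
  shows "braid_chain r s i (i + Suc m) g (u @ x # y # v) =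
     exch_wt r s x y * braid_chain r s (Suc i) (Suc i + m) g ((u @ [y]) @ x # v)
     + (if x < y then (s - r) * braid_chain r s (Suc i) (Suc i + m) g ((u @ [x]) @ y # v) else 0)"
  using assms by (simp add: upt_conv_Cons braid_op_split del: upt_Suc)

text \<open>
  Evaluated at a word, the chain makes the letter \<open>x\<close> travel from position \<open>length u\<close> to the end.
  At each step it either changes places with its right neighbour, or both stay and the neighbour
  goes on travelling. Both ways the letters of \<open>u\<close> stay among the first \<open>n\<close> letters, and a
  repetition among them survives to the end.
\<close>

lemma braid_chain_vanish:
  assumes "\<And>xs d. length xs = n \<Longrightarrow> \<not> distinct xs \<Longrightarrow> g (xs @ [d]) = 0"
    and "\<not> distinct u" "length u + length v = n"
  shows "braid_chain r s (length u) n g (u @ x # v) = 0"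
  using assms(2,3)
proof (induction v arbitrary: u x)
  case Nil
  then show ?case using assms(1) by simp
next
  case (Cons y v)
  then show ?case
    using braid_chain_Cons[OF refl, of r s u "length v" g x y v]
      Cons.IH[of "u @ [y]" x] Cons.IH[of "u @ [x]" y] by auto
qed

text \<open>
  Only a larger letter can take over from \<open>x\<close>. When it does, \<open>x\<close> cannot occur in the rest of
  the increasing word \<open>v\<close>, so it occurs among the letters already passed and is now repeated there;
  by the previous lemma this term vanishes. Only the term in which every step is an exchange remains.
\<close>

lemma braid_chain_sorted:
  assumes "\<And>xs d. length xs = n \<Longrightarrow> \<not> distinct xs \<Longrightarrow> g (xs @ [d]) = 0"
    and "length u + length v = n" "sorted_wrt (<) v" "x \<in> set u \<union> set v"
  shows "braid_chain r s (length u) n g (u @ x # v) =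
     prod_list (map (exch_wt r s x) v) * g (u @ v @ [x])"
  using assms(2-4)
proof (induction v arbitrary: u)
  case (Cons y v)
  have "braid_chain r s (length (u @ [x])) n g ((u @ [x]) @ y # v) = 0" if "x < y"
  proof (rule braid_chain_vanish)
    show "\<not> distinct (u @ [x])" using that Cons.prems by auto
  qed (use assms(1) Cons.prems in auto)
  moreover have "braid_chain r s (length (u @ [y])) n g ((u @ [y]) @ x # v) =
     prod_list (map (exch_wt r s x) v) * g ((u @ [y]) @ v @ [x])"
    using Cons.prems by (intro Cons.IH) auto
  ultimately show ?case
    using braid_chain_Cons[OF refl, of r s u "length v" g x y v] Cons.prems by auto
qed simp

lemma prod_exch_wt:
  assumes "l \<in> {1..n}"
  shows "prod_list (map (exch_wt r s l) [1..<n + 1]) = s * (r * s) ^ (l - 1)"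
proof -
  have "[1..<n + 1] = [1..<l] @ l # [Suc l..<n + 1]"
    using assms upt_add_eq_append[of 1 l "n + 1 - l"] upt_conv_Cons[of l "n + 1"] by simp
  moreover have "map (exch_wt r s l) [1..<l] = replicate (l - 1) (r * s)"
    by (auto simp: exch_wt_def intro!: replicate_eqI)
  moreover have "map (exch_wt r s l) [Suc l..<n + 1] = replicate (n - l) 1"
    by (auto simp: exch_wt_def intro!: replicate_eqI)
  ultimately show ?thesis by (simp add: exch_wt_def)
qed

section \<open>Row vectors and the RTT relations\<close>

text \<open>
  A scalar function \<open>\<tau>\<close> of pairs of words, thought of as a linear functional evaluated at the entries
  of \<open>T_1 T_2 ... T_m\<close>. The equation is the \<open>([a, b], [c, d])\<close> entry of \<open>R T_1 T_2 = T_2 T_1 R\<close>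
  at adjacent positions.
\<close>

definition RTT_form ::
    "nat \<Rightarrow> nat \<Rightarrow> complex \<Rightarrow> complex \<Rightarrow> (nat list \<Rightarrow> nat list \<Rightarrow> complex) \<Rightarrow> bool" where
  "RTT_form n m r s \<tau> \<longleftrightarrow> (\<forall>u a b v u' c d v'.
     length u = length u' \<longrightarrow> u @ a # b # v \<in> tuples n m \<longrightarrow> u' @ c # d # v' \<in> tuples n m \<longrightarrow>
       exch_wt r s a b * \<tau> (u @ a # b # v) (u' @ c # d # v')
       + (if b < a then (s - r) * \<tau> (u @ b # a # v) (u' @ c # d # v') else 0)
     = exch_wt r s c d * \<tau> (u @ b # a # v) (u' @ d # c # v')
       + (if c < d then (s - r) * \<tau> (u @ b # a # v) (u' @ c # d # v') else 0))"

text \<open>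
  Row vector times matrix, cut off outside \<open>tuples n m\<close> so that it commutes with \<open>braid_op\<close> as an
  operator on functions of arbitrary words.
\<close>

definition contract ::
    "nat \<Rightarrow> nat \<Rightarrow> (nat list \<Rightarrow> nat list \<Rightarrow> complex) \<Rightarrow> (nat list \<Rightarrow> complex) \<Rightarrow> nat list \<Rightarrow> complex" where
  "contract n m \<tau> \<psi> ys =
     (if ys \<in> tuples n m then \<Sum>xs\<in>tuples n m. \<psi> xs * \<tau> xs ys else 0)"

text \<open>
  The RTT relation says that \<open>P R\<close> commutes with \<open>T_1 T_2\<close>. Reindexing the sum by the exchange
  of the two letters moves the operator from \<open>\<psi>\<close> to the rows of \<open>\<tau>\<close>, where the relation turns it
  into an operator on the columns.
\<close>

lemma contract_braid_op:
  assumes "RTT_form n m r s \<tau>"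
  shows "contract n m \<tau> (braid_op r s i \<psi>) = braid_op r s i (contract n m \<tau> \<psi>)"
proof
  fix ys
  show "contract n m \<tau> (braid_op r s i \<psi>) ys = braid_op r s i (contract n m \<tau> \<psi>) ys"
  proof (cases "ys \<in> tuples n m \<and> Suc i < m")
    case False
    have "set (ys[i := ys ! Suc i, Suc i := ys ! i]) = set ys" if "Suc i < length ys"
      using that by simp
    then show ?thesis
      using False by (auto simp: contract_def braid_op_def tuples_def)
  next
    case True
    then have "Suc i < length ys" by (simp add: tuples_def)
    then obtain u' c d v' where ys: "ys = u' @ c # d # v'" and u': "length u' = i"
      by (rule split_at_adjacent)
    let ?sw = "\<lambda>xs :: nat list. xs[i := xs ! Suc i, Suc i := xs ! i]"
    have sw: "?sw xs \<in> tuples n m" "?sw (?sw xs) = xs" if "xs \<in> tuples n m" for xs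
      using that True by (auto simp: tuples_def intro!: nth_equalityI simp: nth_list_update)
    have "(\<Sum>xs\<in>tuples n m. exch_wt r s (xs ! i) (xs ! Suc i) * \<psi> (?sw xs) * \<tau> xs ys)
        = (\<Sum>xs\<in>tuples n m. exch_wt r s (xs ! Suc i) (xs ! i) * \<psi> xs * \<tau> (?sw xs) ys)"
      by (rule sum.reindex_bij_witness[where i = ?sw and j = ?sw])
        (use sw True in \<open>auto simp: tuples_def nth_list_update\<close>)
    then have "(\<Sum>xs\<in>tuples n m. braid_op r s i \<psi> xs * \<tau> xs ys)
        = (\<Sum>xs\<in>tuples n m. exch_wt r s (xs ! Suc i) (xs ! i) * \<psi> xs * \<tau> (?sw xs) ys)
        + (\<Sum>xs\<in>tuples n m. (if xs ! i < xs ! Suc i then (s - r) * \<psi> xs else 0) * \<tau> xs ys)"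
      using True by (simp add: braid_op_def tuples_def distrib_right sum.distrib)
    also have "\<dots> = (\<Sum>xs\<in>tuples n m. \<psi> xs * (exch_wt r s (xs ! Suc i) (xs ! i) * \<tau> (?sw xs) ys
        + (if xs ! i < xs ! Suc i then (s - r) * \<tau> xs ys else 0)))"
      unfolding sum.distrib[symmetric] by (intro sum.cong) (simp_all add: distrib_left)
    also have "\<dots> = (\<Sum>xs\<in>tuples n m. \<psi> xs * (exch_wt r s c d * \<tau> xs (u' @ d # c # v')
        + (if c < d then (s - r) * \<tau> xs ys else 0)))"
    proof (intro sum.cong refl arg_cong[where f = "\<lambda>x. _ * x"])
      fix xs assume xs_in: "xs \<in> tuples n m"
      then have "Suc i < length xs" using True by (simp add: tuples_def)
      then obtain u b a v where xs: "xs = u @ b # a # v" and u: "length u = i"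
        by (rule split_at_adjacent)
      have sw_eq: "?sw xs = u @ a # b # v"
        using xs u by (simp add: nth_append list_update_append)
      have at: "xs ! i = b" "xs ! Suc i = a" using xs u by (simp_all add: nth_append)
      have "u @ a # b # v \<in> tuples n m" using xs_in xs by (auto simp: tuples_def)
      moreover have "u' @ c # d # v' \<in> tuples n m" using True ys by simp
      ultimately show "exch_wt r s (xs ! Suc i) (xs ! i) * \<tau> (?sw xs) ys
          + (if xs ! i < xs ! Suc i then (s - r) * \<tau> xs ys else 0)
        = exch_wt r s c d * \<tau> xs (u' @ d # c # v') + (if c < d then (s - r) * \<tau> xs ys else 0)"
        using assms[unfolded RTT_form_def, rule_format, of u u' a b v c d v'] u u'
        unfolding sw_eq unfolding at unfolding xs ys by simp
    qed
    also have "\<dots> = braid_op r s i (contract n m \<tau> \<psi>) ys"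
    proof -
      have "u' @ d # c # v' \<in> tuples n m" using True ys by (auto simp: tuples_def)
      then show ?thesis
        using True unfolding ys braid_op_split[OF u']
        by (simp add: contract_def sum_distrib_left sum.distrib distrib_left mult.left_commute)
    qed
    finally show ?thesis using True by (simp add: contract_def)
  qed
qed

lemma contract_braid_chain:
  assumes "RTT_form n m r s \<tau>"
  shows "contract n m \<tau> (braid_chain r s i j \<psi>) = braid_chain r s i j (contract n m \<tau> \<psi>)"
proof -
  have "contract n m \<tau> (foldr (braid_op r s) is \<psi>) = foldr (braid_op r s) is (contract n m \<tau> \<psi>)" for "is"
    by (induction "is") (simp_all add: contract_braid_op[OF assms])
  then show ?thesis .
qed

lemma finite_tuples: "finite (tuples n m)"
proof -
  have "tuples n m = {xs. set xs \<subseteq> {1..n} \<and> length xs = m}"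
    by (auto simp: tuples_def)
  then show ?thesis by (simp add: finite_lists_length_eq)
qed

section \<open>Commuting a generator past the skew-symmetric row vector\<close>

text \<open>
  The row vector \<open>\<epsilon> \<otimes> e_k\<close>.
\<close>

definition skew_snoc :: "complex \<Rightarrow> nat \<Rightarrow> nat \<Rightarrow> nat list \<Rightarrow> complex" where
  "skew_snoc s n k xs = (if length xs = Suc n \<and> last xs = k then skew s (butlast xs) else 0)"

lemma braid_op_skew_snoc:
  assumes "Suc i < n"
  shows "braid_op r s i (skew_snoc s n k) = (\<lambda>xs. - r * skew_snoc s n k xs)"
proof
  fix xs
  show "braid_op r s i (skew_snoc s n k) xs = - r * skew_snoc s n k xs"
  proof (cases "length xs = Suc n")
    case True
    then obtain zs d where xs: "xs = zs @ [d]" "length zs = n" by (metis length_Suc_conv_rev)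
    have "braid_op r s i (skew_snoc s n k) xs = (if d = k then braid_op r s i (skew s) zs else 0)"
      using assms xs by (auto simp: braid_op_def skew_snoc_def nth_append list_update_append)
    then show ?thesis using braid_op_skew[of i zs] assms xs by (simp add: skew_snoc_def)
  qed (simp add: braid_op_def skew_snoc_def)
qed

lemma eigenvector_after_first_letter:
  assumes "r \<noteq> 0" "r + s \<noteq> 0" and eig: "\<And>i. Suc i < n \<Longrightarrow> braid_op r s (Suc i) g = (\<lambda>xs. - r * g xs)"
    and "xs \<in> tuples n n"
  shows "g (l # xs) = skew s xs * g (l # [1..<n + 1])"
proof (rule eigenvector_eq_skew[OF assms(1,2) _ assms(4), of "\<lambda>xs. g (l # xs)"])
  fix i xs assume "xs \<in> tuples n n" "Suc i < n"
  then have "braid_op r s i (\<lambda>xs. g (l # xs)) xs = braid_op r s (Suc i) g (l # xs)"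
    by (simp add: braid_op_def tuples_def)
  then show "braid_op r s i (\<lambda>xs. g (l # xs)) xs = - r * g (l # xs)"
    using eig[OF \<open>Suc i < n\<close>] by simp
qed

lemma eigenvector_before_last_letter:
  assumes "r \<noteq> 0" "r + s \<noteq> 0" and eig: "\<And>i. Suc i < n \<Longrightarrow> braid_op r s i g = (\<lambda>xs. - r * g xs)"
    and "xs \<in> tuples n n"
  shows "g (xs @ [l]) = skew s xs * g ([1..<n + 1] @ [l])"
proof (rule eigenvector_eq_skew[OF assms(1,2) _ assms(4), of "\<lambda>xs. g (xs @ [l])"])
  fix i xs assume *: "xs \<in> tuples n n" "Suc i < n"
  then have "braid_op r s i (\<lambda>xs. g (xs @ [l])) xs = braid_op r s i g (xs @ [l])"
    by (simp add: braid_op_def tuples_def nth_append list_update_append)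
  then show "braid_op r s i (\<lambda>xs. g (xs @ [l])) xs = - r * g (xs @ [l])"
    using eig[OF \<open>Suc i < n\<close>] by simp
qed

text \<open>
  For a vector that is skew in its first \<open>n\<close> factors, carrying the last letter to the front is a
  mere multiplication by \<open>s (rs)^(l-1)\<close>. By the shift lemma the result is skew in its last \<open>n\<close>
  factors, so it suffices to compare coefficients at the sorted word.
\<close>

lemma braid_chain_skew_front:
  assumes rs: "r \<noteq> 0" "r + s \<noteq> 0"
    and eig: "\<And>i. Suc i < n \<Longrightarrow> braid_op r s i g = (\<lambda>xs. - r * g xs)"
    and van: "\<And>xs d. length xs = n \<Longrightarrow> \<not> distinct xs \<Longrightarrow> g (xs @ [d]) = 0"
    and l: "l \<in> {1..n}" and xs: "xs \<in> tuples n n"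
  shows "braid_chain r s 0 n g (l # xs) = s * (r * s) ^ (l - 1) * g (xs @ [l])"
proof -
  have "braid_chain r s 0 n g (l # xs) = skew s xs * braid_chain r s 0 n g (l # [1..<n + 1])"
  proof (rule eigenvector_after_first_letter[OF rs _ xs])
    fix i assume "Suc i < n"
    then show "braid_op r s (Suc i) (braid_chain r s 0 n g) = (\<lambda>xs. - r * braid_chain r s 0 n g xs)"
      by (simp only: braid_chain_shift eig braid_chain_scale)
  qed
  also have "braid_chain r s 0 n g (l # [1..<n + 1]) = s * (r * s) ^ (l - 1) * g ([1..<n + 1] @ [l])"
    using braid_chain_sorted[where n = n and g = g and u = "[]" and v = "[1..<n + 1]" and x = l
        and r = r and s = s, OF van] l prod_exch_wt[OF l, of r s]
    by (simp del: upt_Suc)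
  finally show ?thesis
    using eigenvector_before_last_letter[OF rs eig xs, of l] by simp
qed

text \<open>
  The scalar form of the claim. The row vector \<open>(\<epsilon> \<otimes> e_k) T_1 ... T_(n+1)\<close> is skew in its first
  \<open>n\<close> factors because \<open>\<epsilon>\<close> is. Carrying the last factor to the front multiplies its coefficient
  at the word \<open>ys @ [l]\<close> by \<open>s (rs)^(l-1)\<close>; done before multiplying with
  \<open>T_1 ... T_(n+1)\<close>, it turns \<open>\<epsilon> \<otimes> e_k\<close> into \<open>s (rs)^(k-1) e_k \<otimes> \<epsilon>\<close>.
\<close>

lemma skew_contraction_commutes:
  assumes rs: "r \<noteq> 0" "s \<noteq> 0" "r + s \<noteq> 0" and \<tau>: "RTT_form n (Suc n) r s \<tau>"
    and k: "k \<in> {1..n}" and l: "l \<in> {1..n}" and ys: "ys \<in> tuples n n"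
  shows "(r * s) ^ (l - 1) * (\<Sum>xs\<in>tuples n n. skew s xs * \<tau> (xs @ [k]) (ys @ [l]))
       = (r * s) ^ (k - 1) * (\<Sum>xs\<in>tuples n n. skew s xs * \<tau> (k # xs) (l # ys))"
proof -
  let ?g = "skew_snoc s n k" and ?F = "contract n (Suc n) \<tau> (skew_snoc s n k)"
  have F_eig: "braid_op r s i ?F = (\<lambda>xs. - r * ?F xs)" if "Suc i < n" for i
  proof -
    have "braid_op r s i ?F = contract n (Suc n) \<tau> (\<lambda>xs. - r * ?g xs)"
      by (simp only: contract_braid_op[OF \<tau>, symmetric] braid_op_skew_snoc[OF that])
    then show ?thesis
      by (auto simp: contract_def fun_eq_iff sum_distrib_left mult.assoc sum_negf)
  qed
  have F_van: "?F (zs @ [d]) = 0" if "length zs = n" "\<not> distinct zs" for zs d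
  proof (cases "zs \<in> tuples n n")
    case True
    then show ?thesis
      using eigenvector_before_last_letter[OF rs(1,3) F_eig True, of d] that by (simp add: skew_def)
  next
    case False
    then show ?thesis using that by (auto simp: contract_def tuples_def)
  qed
  have tup_Cons: "a # zs \<in> tuples n (Suc n) \<longleftrightarrow> a \<in> {1..n} \<and> zs \<in> tuples n n"
    and tup_snoc: "zs @ [a] \<in> tuples n (Suc n) \<longleftrightarrow> a \<in> {1..n} \<and> zs \<in> tuples n n" for a zs
    by (auto simp: tuples_def)
  (* the chain turns \<epsilon> \<otimes> e_k into a multiple of e_k \<otimes> \<epsilon> *)
  have front: "braid_chain r s 0 n ?g (a # zs) = (if a = k then s * (r * s) ^ (k - 1) * skew s zs else 0)"
    if "a # zs \<in> tuples n (Suc n)" for a zs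
  proof -
    have "braid_chain r s 0 n ?g (a # zs) = s * (r * s) ^ (a - 1) * ?g (zs @ [a])"
      using that by (intro braid_chain_skew_front rs braid_op_skew_snoc)
        (auto simp: tup_Cons skew_snoc_def skew_def)
    then show ?thesis using that by (auto simp: skew_snoc_def tuples_def)
  qed
  (* both evaluations of the chain meet because it commutes with the contraction *)
  have "s * (r * s) ^ (l - 1) * ?F (ys @ [l]) = braid_chain r s 0 n ?F (l # ys)"
    by (intro braid_chain_skew_front[symmetric] rs F_eig F_van l ys)
  also have "\<dots> = contract n (Suc n) \<tau> (braid_chain r s 0 n ?g) (l # ys)"
    by (simp only: contract_braid_chain[OF \<tau>])
  also have "\<dots> = (\<Sum>xs\<in>tuples n (Suc n). braid_chain r s 0 n ?g xs * \<tau> xs (l # ys))"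
    using l ys by (simp add: contract_def tup_Cons del: upt_Suc)
  also have "\<dots> = (\<Sum>xs\<in>(#) k ` tuples n n. braid_chain r s 0 n ?g xs * \<tau> xs (l # ys))"
  proof (rule sum.mono_neutral_right[OF finite_tuples])
    show "\<forall>xs\<in>tuples n (Suc n) - (#) k ` tuples n n. braid_chain r s 0 n ?g xs * \<tau> xs (l # ys) = 0"
    proof
      fix xs assume xs: "xs \<in> tuples n (Suc n) - (#) k ` tuples n n"
      then obtain a zs where azs: "xs = a # zs" by (cases xs) (auto simp: tuples_def)
      with xs have "a \<noteq> k" by (auto simp: tup_Cons)
      then show "braid_chain r s 0 n ?g xs * \<tau> xs (l # ys) = 0"
        using front[of a zs] xs azs by auto
    qed
  qed (use k in \<open>auto simp: tup_Cons\<close>)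
  also have "\<dots> = s * (r * s) ^ (k - 1) * (\<Sum>xs\<in>tuples n n. skew s xs * \<tau> (k # xs) (l # ys))"
    using k by (simp add: sum.reindex front tup_Cons sum_distrib_left mult.assoc del: upt_Suc)
  finally have "s * (r * s) ^ (l - 1) * ?F (ys @ [l])
    = s * (r * s) ^ (k - 1) * (\<Sum>xs\<in>tuples n n. skew s xs * \<tau> (k # xs) (l # ys))" .
  moreover have "?F (ys @ [l]) = (\<Sum>xs\<in>tuples n n. skew s xs * \<tau> (xs @ [k]) (ys @ [l]))"
  proof -
    have "?F (ys @ [l]) = (\<Sum>xs\<in>tuples n (Suc n). ?g xs * \<tau> xs (ys @ [l]))"
      using l ys by (simp add: contract_def tup_snoc)
    also have "\<dots> = (\<Sum>xs\<in>(\<lambda>zs. zs @ [k]) ` tuples n n. ?g xs * \<tau> xs (ys @ [l]))"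
    proof (rule sum.mono_neutral_right[OF finite_tuples])
      show "\<forall>xs\<in>tuples n (Suc n) - (\<lambda>zs. zs @ [k]) ` tuples n n. ?g xs * \<tau> xs (ys @ [l]) = 0"
      proof
        fix xs assume xs: "xs \<in> tuples n (Suc n) - (\<lambda>zs. zs @ [k]) ` tuples n n"
        then obtain a zs where azs: "xs = zs @ [a]" by (cases xs rule: rev_cases) (auto simp: tuples_def)
        with xs have "a \<noteq> k" by (auto simp: tup_snoc)
        then show "?g xs * \<tau> xs (ys @ [l]) = 0" by (simp add: azs skew_snoc_def)
      qed
    qed (use k in \<open>auto simp: tup_snoc\<close>)
    also have "\<dots> = (\<Sum>xs\<in>tuples n n. skew s xs * \<tau> (xs @ [k]) (ys @ [l]))"
      by (auto simp: sum.reindex inj_on_def skew_snoc_def tuples_def intro!: sum.cong)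
    finally show ?thesis .
  qed
  ultimately show ?thesis using rs(2) by simp
qed

section \<open>The coordinates of \<open>\<langle>\<epsilon>|\<close>\<close>

lemma inversions_snoc: "inversions (xs @ [x]) = inversions xs + length (filter (\<lambda>y. x < y) xs)"
  by (induction xs) auto

lemma inversions_map_upt:
  "inversions (map f [a..<b]) = card {(i, j). a \<le> i \<and> i < j \<and> j < b \<and> f j < f i}"
proof (induction b)
  case (Suc b)
  show ?case
  proof (cases "a \<le> b")
    case True
    let ?old = "{(i, j). a \<le> i \<and> i < j \<and> j < b \<and> f j < f i}"
    let ?I = "{i. a \<le> i \<and> i < b \<and> f b < f i}"
    have "length (filter (\<lambda>y. f b < y) (map f [a..<b])) = length (filter (\<lambda>i. f b < f i) [a..<b])"
      by (simp add: filter_map o_def)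
    also have "\<dots> = card (set (filter (\<lambda>i. f b < f i) [a..<b]))"
      by (metis distinct_card distinct_filter distinct_upt)
    also have "set (filter (\<lambda>i. f b < f i) [a..<b]) = ?I" by auto
    finally have "length (filter (\<lambda>y. f b < y) (map f [a..<b])) = card ((\<lambda>i. (i, b)) ` ?I)"
      by (simp add: card_image inj_on_def)
    moreover have "{(i, j). a \<le> i \<and> i < j \<and> j < Suc b \<and> f j < f i} = ?old \<union> (\<lambda>i. (i, b)) ` ?I"
      by (auto simp: less_Suc_eq)
    moreover have "card (?old \<union> (\<lambda>i. (i, b)) ` ?I) = card ?old + card ((\<lambda>i. (i, b)) ` ?I)"
    proof (rule card_Un_disjoint)
      show "finite ?old" by (rule finite_subset[of _ "{..<b} \<times> {..<b}"]) auto
    qed auto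
    ultimately show ?thesis
      using True Suc.IH by (simp add: inversions_snoc)
  next
    case False
    then have "{(i, j). a \<le> i \<and> i < j \<and> j < Suc b \<and> f j < f i} = {}" by auto
    then have "card {(i, j). a \<le> i \<and> i < j \<and> j < Suc b \<and> f j < f i} = 0"
      by (simp only: card.empty)
    with False show ?thesis by simp
  qed
qed simp

lemma inv_count_eq_inversions: "inv_count n \<sigma> = inversions (perm_tuple n \<sigma>)"
  unfolding inv_count_def perm_tuple_def inversions_map_upt
  by (intro arg_cong[where f = card]) auto

text \<open>
  A word in \<open>tuples n n\<close> without repetition is the tuple of exactly one permutation.
\<close>

lemma eps_bra_eq_skew:
  assumes "xs \<in> tuples n n"
  shows "eps_bra n r s xs = skew s xs / rs_fact r s n"
proof -
  have "(\<Sum>\<sigma> | \<sigma> permutes {1..n}. (- s) ^ inv_count n \<sigma> * (if xs = perm_tuple n \<sigma> then 1 else 0))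
      = skew s xs"
  proof (cases "distinct xs")
    case True
    have len: "length xs = n" and set_xs: "set xs = {1..n}"
      using assms True by (auto simp: tuples_def card_subset_eq distinct_card)
    define \<pi> where "\<pi> i = (if i \<in> {1..n} then xs ! (i - 1) else i)" for i
    have "bij_betw \<pi> {1..n} {1..n}"
    proof (rule bij_betw_byWitness)
      define \<rho> where "\<rho> y = Suc (inv_into {..<n} ((!) xs) y)" for y
      have inj: "inj_on ((!) xs) {..<n}" using True len by (simp add: inj_on_nth)
      have im: "(!) xs ` {..<n} = {1..n}" using len set_xs by (auto simp: set_conv_nth)
      show "\<forall>i\<in>{1..n}. \<rho> (\<pi> i) = i"
        using inj by (auto simp: \<rho>_def \<pi>_def)
      show "\<forall>y\<in>{1..n}. \<pi> (\<rho> y) = y"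
      proof
        fix y assume "y \<in> {1..n}"
        then have "y \<in> (!) xs ` {..<n}" using im by simp
        then have "inv_into {..<n} ((!) xs) y \<in> {..<n}" "xs ! inv_into {..<n} ((!) xs) y = y"
          by (rule inv_into_into, rule f_inv_into_f)
        then show "\<pi> (\<rho> y) = y" by (auto simp: \<rho>_def \<pi>_def)
      qed
      show "\<pi> ` {1..n} \<subseteq> {1..n}"
      proof -
        have "xs ! (i - 1) \<in> {1..n}" if "i \<in> {1..n}" for i
          using that len nth_mem[of "i - 1" xs] unfolding set_xs by force
        then show ?thesis by (auto simp: \<pi>_def)
      qed
      show "\<rho> ` {1..n} \<subseteq> {1..n}"
      proof
        fix j assume "j \<in> \<rho> ` {1..n}"
        then obtain y where "j = \<rho> y" "y \<in> (!) xs ` {..<n}" using im by auto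
        then show "j \<in> {1..n}" using inv_into_into[of y "(!) xs" "{..<n}"] by (auto simp: \<rho>_def)
      qed
    qed
    then have \<pi>: "\<pi> permutes {1..n}" by (rule bij_imp_permutes) (auto simp: \<pi>_def)
    have tup: "perm_tuple n \<pi> = xs"
      using len by (auto simp: perm_tuple_def \<pi>_def intro!: nth_equalityI simp del: upt_Suc)
    have "xs = perm_tuple n \<sigma> \<longleftrightarrow> \<sigma> = \<pi>" if "\<sigma> permutes {1..n}" for \<sigma>
    proof
      assume "xs = perm_tuple n \<sigma>"
      then have eq: "map \<sigma> [1..<n + 1] = map \<pi> [1..<n + 1]" using tup by (simp add: perm_tuple_def)
      show "\<sigma> = \<pi>"
      proof
        fix i
        show "\<sigma> i = \<pi> i"
        proof (cases "i \<in> {1..n}")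
          case True
          then show ?thesis using eq by (simp add: map_eq_conv del: upt_Suc)
        next
          case False
          then show ?thesis using that \<pi> by (simp add: permutes_not_in)
        qed
      qed
    qed (simp add: tup)
    then have "(\<Sum>\<sigma> | \<sigma> permutes {1..n}. (- s) ^ inv_count n \<sigma> * (if xs = perm_tuple n \<sigma> then 1 else 0))
      = (\<Sum>\<sigma> | \<sigma> permutes {1..n}. if \<sigma> = \<pi> then (- s) ^ inv_count n \<sigma> else 0)"
      by (intro sum.cong) auto
    also have "\<dots> = (- s) ^ inv_count n \<pi>"
      using \<pi> by (simp add: finite_permutations)
    finally show ?thesis using True by (simp add: skew_def inv_count_eq_inversions tup)
  next
    case False
    have "distinct (perm_tuple n \<sigma>)" if "\<sigma> permutes {1..n}" for \<sigma>
      using permutes_inj_on[OF that] by (simp add: perm_tuple_def distinct_map del: upt_Suc)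
    then have "xs \<noteq> perm_tuple n \<sigma>" if "\<sigma> permutes {1..n}" for \<sigma> using that False by blast
    then show ?thesis using False by (simp add: skew_def)
  qed
  then show ?thesis by (simp add: eps_bra_def)
qed

section \<open>Linear functionals and ideals of the free algebra\<close>

text \<open>
  The scalar multiplication of the free algebra as a function of its own, so that it can be
  used with the vector space locales.
\<close>

definition free_scale :: "complex \<Rightarrow> 'g free \<Rightarrow> 'g free" where
  "free_scale c p = Poly_Mapping.single 0 c * p"

lemma vector_space_free_scale: "vector_space free_scale"
  by standard
    (simp_all add: free_scale_def distrib_left distrib_right single_add mult_single
      flip: mult.assoc)

lemma subspace_separated_by_functional:
  assumes "vector_space scale" "module.subspace scale S" "p \<notin> S"
  obtains \<phi> :: "_ \<Rightarrow> 'k :: field" where "Vector_Spaces.linear scale (*) \<phi>" "\<And>x. x \<in> S \<Longrightarrow> \<phi> x = 0" "\<phi> p \<noteq> 0"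
proof -
  interpret vector_space scale by (rule assms(1))
  interpret K: vector_space "(*) :: 'k \<Rightarrow> 'k \<Rightarrow> 'k" by standard (simp_all add: algebra_simps)
  interpret vector_space_pair scale "(*) :: 'k \<Rightarrow> 'k \<Rightarrow> 'k" ..
  (* a basis of S together with p is independent: prescribe 0 on the basis and 1 at p *)
  obtain B where B: "B \<subseteq> S" "independent B" "S \<subseteq> span B" "card B = dim S"
    by (rule basis_exists)
  have span: "span B = S"
    by (rule span_subspace[OF B(1,3) assms(2)])
  with assms(3) have "p \<notin> span B" by simp
  then have "independent (insert p B)" by (rule independent_insertI[OF _ B(2)])
  from linear_independent_extend[OF this, of "\<lambda>x. if x = p then 1 else 0"]
  obtain \<phi> where \<phi>: "Vector_Spaces.linear scale (*) \<phi>"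
    "\<forall>x\<in>insert p B. \<phi> x = (if x = p then 1 else 0)"
    by blast
  have "\<phi> x = 0" if "x \<in> S" for x
  proof (rule linear_eq_0_on_span[OF \<phi>(1)])
    show "x \<in> span B" using that span by simp
    show "\<And>x. x \<in> B \<Longrightarrow> \<phi> x = 0" using \<phi>(2) B(1) assms(3) by auto
  qed
  moreover have "\<phi> p \<noteq> 0" using \<phi>(2) by simp
  ultimately show thesis using \<phi>(1) by (intro that)
qed

lemma single_0_in_free_algebra: "Poly_Mapping.single 0 c \<in> carrier (free_algebra G)"
  by (simp add: free_algebra_def zero_fword_def)

text \<open>
  Ideals are subspaces, and a vector outside a subspace is detected by a functional vanishing on it.
  This turns congruences modulo the ideal into equations between complex numbers.
\<close>

lemma mem_ideal_by_functionals:
  assumes "ideal I (free_algebra G)"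
    and "\<And>\<phi>. Vector_Spaces.linear free_scale (*) \<phi> \<Longrightarrow> (\<And>x. x \<in> I \<Longrightarrow> \<phi> x = 0) \<Longrightarrow> \<phi> p = (0 :: complex)"
  shows "p \<in> I"
proof (rule ccontr)
  assume p: "p \<notin> I"
  interpret ideal I "free_algebra G" by (rule assms(1))
  interpret vector_space free_scale by (rule vector_space_free_scale)
  have "subspace I"
  proof (rule subspaceI)
    show "0 \<in> I" using additive_subgroup.zero_closed[OF is_additive_subgroup] by (simp add: free_algebra_def)
    show "x + y \<in> I" if "x \<in> I" "y \<in> I" for x y
      using additive_subgroup.a_closed[OF is_additive_subgroup that] by (simp add: free_algebra_def)
    show "free_scale c x \<in> I" if "x \<in> I" for c x
      using I_l_closed[OF that single_0_in_free_algebra, of c] by (simp add: free_algebra_def free_scale_def)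
  qed
  from subspace_separated_by_functional[OF vector_space_free_scale this p]
  obtain \<phi> :: "_ \<Rightarrow> complex" where \<phi>: "Vector_Spaces.linear free_scale (*) \<phi>"
    "\<And>x. x \<in> I \<Longrightarrow> \<phi> x = 0" "\<phi> p \<noteq> 0" by blast
  from assms(2)[OF \<phi>(1,2)] \<phi>(3) show False by simp
qed

section \<open>Monomials and relators in the free algebra\<close>

text \<open>
  The monomial \<open>t_{x1 y1} ... t_{xm ym}\<close>, an entry of \<open>T_1 ... T_m\<close>. As a single word it
  visibly lies in the carrier and commutes with scalars.
\<close>

definition t_word :: "nat list \<Rightarrow> nat list \<Rightarrow> gl_gen free" where
  "t_word xs ys = Poly_Mapping.single (Fword (map2 GenT xs ys)) 1"

lemma gen_elem_eq_t_word: "gen_elem (GenT i j) = t_word [i] [j]"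
  by (simp add: gen_elem_def t_word_def)

lemma t_word_append:
  "length xs = length ys \<Longrightarrow> t_word (xs @ xs') (ys @ ys') = t_word xs ys * t_word xs' ys'"
  by (simp add: t_word_def mult_single plus_fword_def)

lemma t_word_Nil: "t_word [] [] = 1"
  by (simp add: t_word_def flip: zero_fword_def)

lemma t_word_mult_scale: "t_word xs ys * free_scale c p = free_scale c (t_word xs ys * p)"
proof -
  have "t_word xs ys * Poly_Mapping.single 0 c = Poly_Mapping.single 0 c * t_word xs ys"
    by (simp add: t_word_def mult_single)
  then show ?thesis by (simp add: free_scale_def flip: mult.assoc)
qed

lemma t_word_carrier:
  assumes "set xs \<subseteq> {1..n}" "set ys \<subseteq> {1..n}"
  shows "t_word xs ys \<in> carrier (free_algebra (gl_gens n))"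
proof -
  have "GenT i j \<in> gl_gens n" if "(i, j) \<in> set (zip xs ys)" for i j
    using set_zip_leftD[OF that] set_zip_rightD[OF that] assms by (auto simp: gl_gens_def)
  then show ?thesis by (auto simp: t_word_def free_algebra_def)
qed

lemma finsum_free_algebra:
  assumes "\<And>x. x \<in> J \<Longrightarrow> f x \<in> carrier (free_algebra G)"
  shows "finsum (free_algebra G) f J = sum f J"
proof -
  interpret ring "free_algebra G" by (rule ring_free_algebra)
  show ?thesis
    using assms
  proof (induction J rule: infinite_finite_induct)
    case (insert x J)
    then have "finsum (free_algebra G) f (insert x J) = f x \<oplus>\<^bsub>free_algebra G\<^esub> finsum (free_algebra G) f J"
      by (intro finsum_insert) auto
    moreover have "p \<oplus>\<^bsub>free_algebra G\<^esub> q = p + q" for p q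
      by (simp add: free_algebra_def)
    ultimately show ?case using insert by simp
  next
    case empty
    have "\<zero>\<^bsub>free_algebra G\<^esub> = 0" by (simp add: free_algebra_def)
    then show ?case by simp
  next
    case (infinite J)
    have "\<zero>\<^bsub>free_algebra G\<^esub> = 0" by (simp add: free_algebra_def)
    then show ?case using infinite by (simp add: finsum_infinite)
  qed
qed

lemma R_mat_entries:
  assumes "a \<in> {1..n}" "b \<in> {1..n}"
  shows "R_mat n r s [a, b] [c, d] =
    (if a = c \<and> b = d then exch_wt r s a b else 0) + (if b < a \<and> a = d \<and> b = c then s - r else 0)"
proof -
  have delta: "(\<Sum>i\<in>{1..n}. \<Sum>j\<in>{j\<in>{1..n}. P i j}. tensor2 (mat_unit i (f i j)) (mat_unit j (g i j)) [a, b] [c, d])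
     = (if P a b \<and> c = f a b \<and> d = g a b then 1 else 0)" for P f g
  proof -
    let ?X = "if P a b \<and> c = f a b \<and> d = g a b then 1 else 0 :: complex"
    have "(\<Sum>j\<in>{j\<in>{1..n}. P i j}. tensor2 (mat_unit i (f i j)) (mat_unit j (g i j)) [a, b] [c, d])
      = (if i = a then ?X else 0)" for i
    proof -
      have "(\<Sum>j\<in>{j\<in>{1..n}. P i j}. tensor2 (mat_unit i (f i j)) (mat_unit j (g i j)) [a, b] [c, d])
        = (\<Sum>j\<in>{1..n}. if j = b then (if i = a then ?X else 0) else 0)"
        unfolding sum.inter_filter[OF finite_atLeastAtMost]
      proof (intro sum.cong refl)
        fix j
        show "(if P i j then tensor2 (mat_unit i (f i j)) (mat_unit j (g i j)) [a, b] [c, d] else 0) =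
          (if j = b then (if i = a then ?X else 0) else 0)"
          by (cases "i = a"; cases "j = b") (simp_all add: tensor2_def mat_unit_def)
      qed
      also have "\<dots> = (if i = a then ?X else 0)" using assms(2) by (simp only: sum.delta finite_atLeastAtMost if_True)
      finally show ?thesis .
    qed
    then show ?thesis using assms(1) by (simp only: sum.delta finite_atLeastAtMost if_True)
  qed
  have diag: "(\<Sum>i\<in>{1..n}. tensor2 (mat_unit i i) (mat_unit i i) [a, b] [c, d])
      = (if a = b \<and> c = a \<and> d = b then 1 else 0)"
  proof -
    have "(\<Sum>i\<in>{1..n}. tensor2 (mat_unit i i) (mat_unit i i) [a, b] [c, d])
      = (\<Sum>i\<in>{1..n}. if i = a then if a = b \<and> c = a \<and> d = b then 1 else 0 else 0)"
      by (intro sum.cong refl) (auto simp: tensor2_def mat_unit_def)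
    then show ?thesis using assms by (simp add: sum.delta)
  qed
  show ?thesis
    unfolding R_mat_def diag
      delta[where P = "\<lambda>i j. j < i" and f = "\<lambda>i j. i" and g = "\<lambda>i j. j"]
      delta[where P = "\<lambda>i j. i < j" and f = "\<lambda>i j. i" and g = "\<lambda>i j. j"]
      delta[where P = "\<lambda>i j. j < i" and f = "\<lambda>i j. j" and g = "\<lambda>i j. i"]
    by (cases a b rule: linorder_cases) (simp_all add: exch_wt_def)
qed

lemma free_algebra_operations:
  "p \<otimes>\<^bsub>free_algebra G\<^esub> q = p * q" "p \<oplus>\<^bsub>free_algebra G\<^esub> q = p + q"
  "\<one>\<^bsub>free_algebra G\<^esub> = 1" "\<zero>\<^bsub>free_algebra G\<^esub> = 0"
  "c \<odot>\<^bsub>free_algebra G\<^esub> p = free_scale c p"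
  by (simp_all add: free_algebra_def free_scale_def)

lemma free_algebra_mult_closed:
  assumes "p \<in> carrier (free_algebra G)" "q \<in> carrier (free_algebra G)"
  shows "p * q \<in> carrier (free_algebra G)"
  using monoid.m_closed[OF ring.is_monoid[OF ring_free_algebra] assms]
  by (simp add: free_algebra_operations)

lemma free_algebra_scale_closed:
  "p \<in> carrier (free_algebra G) \<Longrightarrow> free_scale c p \<in> carrier (free_algebra G)"
  using free_algebra_smult[of p G c] by (simp add: free_algebra_operations)

lemma free_algebra_zero_one_closed:
  "0 \<in> carrier (free_algebra G)" "1 \<in> carrier (free_algebra G)"
  by (simp_all add: free_algebra_def zero_fword_def flip: single_one)

lemma free_algebra_sum_closed:
  assumes "\<And>x. x \<in> J \<Longrightarrow> f x \<in> carrier (free_algebra G)"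
  shows "sum f J \<in> carrier (free_algebra G)"
proof -
  interpret ring "free_algebra G" by (rule ring_free_algebra)
  have "finsum (free_algebra G) f J \<in> carrier (free_algebra G)"
    using assms by (intro finsum_closed) auto
  then show ?thesis by (simp add: finsum_free_algebra assms)
qed

lemma mat_mult_free_algebra:
  assumes "\<And>k. k \<in> J \<Longrightarrow> X i k \<in> carrier (free_algebra G)"
    and "\<And>k. k \<in> J \<Longrightarrow> Y k j \<in> carrier (free_algebra G)"
  shows "mat_mult (free_algebra G) J X Y i j = (\<Sum>k\<in>J. X i k * Y k j)"
  using assms by (simp add: mat_mult_def free_algebra_operations finsum_free_algebra free_algebra_mult_closed)

lemma sum_tuples_2: "(\<Sum>xs\<in>tuples n 2. f xs) = (\<Sum>x\<in>{1..n}. \<Sum>y\<in>{1..n}. f [x, y])"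
proof -
  have "(\<Sum>xs\<in>tuples n 2. f xs) = (\<Sum>(x, y)\<in>{1..n} \<times> {1..n}. f [x, y])"
  proof (rule sum.reindex_bij_witness[where i = "\<lambda>(x, y). [x, y]" and j = "\<lambda>xs. (xs ! 0, xs ! 1)"])
    fix xs assume "xs \<in> tuples n 2"
    then obtain x y where "xs = [x, y]" "x \<in> {1..n}" "y \<in> {1..n}"
      by (auto simp: tuples_def numeral_2_eq_2 length_Suc_conv)
    then show "(case (xs ! 0, xs ! 1) of (x, y) \<Rightarrow> [x, y]) = xs"
      "(xs ! 0, xs ! 1) \<in> {1..n} \<times> {1..n}"
      "(case (xs ! 0, xs ! 1) of (x, y) \<Rightarrow> f [x, y]) = f xs" by simp_all
  qed (auto simp: tuples_def)
  then show ?thesis by (simp add: sum.cartesian_product)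
qed

lemma sum_sum_delta:
  assumes "finite J" "a \<in> J" "b \<in> J"
  shows "(\<Sum>x\<in>J. \<Sum>y\<in>J. if x = a \<and> y = b then f x y else 0) = (f a b :: 'a :: comm_monoid_add)"
proof -
  have "(\<Sum>y\<in>J. if x = a \<and> y = b then f x y else 0) = (if x = a then f x b else 0)" for x
    using assms by (cases "x = a") simp_all
  then show ?thesis using assms by simp
qed

lemma free_scale_simps:
  "free_scale (c + d) p = free_scale c p + free_scale d p"
  "free_scale 0 p = 0" "free_scale c (free_scale d p) = free_scale (c * d) p"
  "free_scale c p * q = free_scale c (p * q)" "free_scale c 0 = 0" "free_scale 1 p = p"
proof -
  show "free_scale c (free_scale d p) = free_scale (c * d) p"
    by (simp add: free_scale_def mult_single flip: mult.assoc)
qed (simp_all add: free_scale_def distrib_right single_add mult.assoc)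

text \<open>
  The \<open>([a, b], [c, d])\<close> entry of \<open>R T_1 T_2 - T_2 T_1 R\<close>, multiplied out.
\<close>

definition rtt_relator ::
    "complex \<Rightarrow> complex \<Rightarrow> nat \<Rightarrow> nat \<Rightarrow> nat \<Rightarrow> nat \<Rightarrow> gl_gen free" where
  "rtt_relator r s a b c d =
     free_scale (exch_wt r s a b) (t_word [a, b] [c, d])
     + free_scale (if b < a then s - r else 0) (t_word [b, a] [c, d])
     - (free_scale (exch_wt r s c d) (t_word [b, a] [d, c])
     + free_scale (if c < d then s - r else 0) (t_word [b, a] [c, d]))"

lemma rtt_relator_mem:
  assumes a: "a \<in> {1..n}" and b: "b \<in> {1..n}" and c: "c \<in> {1..n}" and d: "d \<in> {1..n}"
  shows "rtt_relator r s a b c d \<in> RTT_relators n r s"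
proof -
  let ?A = "free_algebra (gl_gens n)" and ?J = "tuples n 2"
  let ?T = "\<lambda>i j. gen_elem (GenT i j)"
  let ?R = "scalar_mat ?A (R_mat n r s)"
  have J: "[x, y] \<in> ?J \<longleftrightarrow> x \<in> {1..n} \<and> y \<in> {1..n}" for x y by (auto simp: tuples_def)
  have J_E: "\<exists>x\<in>{1..n}. \<exists>y\<in>{1..n}. xs = [x, y]" if xs: "xs \<in> ?J" for xs
  proof -
    obtain x y where "xs = [x, y]" using xs by (auto simp: tuples_def numeral_2_eq_2 length_Suc_conv)
    then show ?thesis using xs J by blast
  qed
  have R: "?R xs ys = free_scale (R_mat n r s xs ys) 1" for xs ys
    by (simp add: scalar_mat_def free_algebra_operations)
  have R_closed: "?R xs ys \<in> carrier ?A" for xs ys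
    unfolding R by (intro free_algebra_scale_closed free_algebra_zero_one_closed)
  have leg1: "leg ?A ?T 1 [x, y] [z, w] = (if y = w then t_word [x] [z] else 0)" for x y z w
    by (auto simp: leg_def gen_elem_eq_t_word free_algebra_operations less_Suc_eq)
  have leg2: "leg ?A ?T 2 [x, y] [z, w] = (if x = z then t_word [y] [w] else 0)" for x y z w
    by (auto simp: leg_def gen_elem_eq_t_word free_algebra_operations less_Suc_eq)
  have leg_closed: "leg ?A ?T k xs ys \<in> carrier ?A" if "xs \<in> ?J" "ys \<in> ?J" "k = 1 \<or> k = 2" for k xs ys
    using J_E[OF that(1)] J_E[OF that(2)] that(3)
    by (auto simp: leg1[simplified] leg2 free_algebra_zero_one_closed intro!: t_word_carrier)
  have T12: "mat_mult ?A ?J (leg ?A ?T 1) (leg ?A ?T 2) [x, y] [z, w] = t_word [x, y] [z, w]"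
    if "x \<in> {1..n}" "y \<in> {1..n}" "z \<in> {1..n}" "w \<in> {1..n}" for x y z w
  proof -
    have "mat_mult ?A ?J (leg ?A ?T 1) (leg ?A ?T 2) [x, y] [z, w]
      = (\<Sum>xs\<in>?J. leg ?A ?T 1 [x, y] xs * leg ?A ?T 2 xs [z, w])"
      using that by (intro mat_mult_free_algebra leg_closed) (auto simp: J)
    also have "\<dots> = (\<Sum>p\<in>{1..n}. \<Sum>q\<in>{1..n}. if p = z \<and> q = y then t_word [x] [p] * t_word [q] [w] else 0)"
      unfolding sum_tuples_2 leg1 leg2 by (intro sum.cong refl) auto
    also have "\<dots> = t_word [x] [z] * t_word [y] [w]"
      using that by (intro sum_sum_delta) auto
    finally show ?thesis using t_word_append[of "[x]" "[z]" "[y]" "[w]"] by simp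
  qed
  have T21: "mat_mult ?A ?J (leg ?A ?T 2) (leg ?A ?T 1) [x, y] [z, w] = t_word [y, x] [w, z]"
    if "x \<in> {1..n}" "y \<in> {1..n}" "z \<in> {1..n}" "w \<in> {1..n}" for x y z w
  proof -
    have "mat_mult ?A ?J (leg ?A ?T 2) (leg ?A ?T 1) [x, y] [z, w]
      = (\<Sum>xs\<in>?J. leg ?A ?T 2 [x, y] xs * leg ?A ?T 1 xs [z, w])"
      using that by (intro mat_mult_free_algebra leg_closed) (auto simp: J)
    also have "\<dots> = (\<Sum>p\<in>{1..n}. \<Sum>q\<in>{1..n}. if p = x \<and> q = w then t_word [y] [q] * t_word [p] [z] else 0)"
      unfolding sum_tuples_2 leg1 leg2 by (intro sum.cong refl) auto
    also have "\<dots> = t_word [y] [w] * t_word [x] [z]"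
      using that by (intro sum_sum_delta) auto
    finally show ?thesis using t_word_append[of "[y]" "[w]" "[x]" "[z]"] by simp
  qed
  have closed: "mat_mult ?A ?J (leg ?A ?T 1) (leg ?A ?T 2) xs ys \<in> carrier ?A"
    "mat_mult ?A ?J (leg ?A ?T 2) (leg ?A ?T 1) xs ys \<in> carrier ?A" if "xs \<in> ?J" "ys \<in> ?J" for xs ys
    using J_E[OF that(1)] J_E[OF that(2)] by (auto simp: T12 T21 simp del: One_nat_def intro!: t_word_carrier)
  have "mat_mult ?A ?J ?R (mat_mult ?A ?J (leg ?A ?T 1) (leg ?A ?T 2)) [a, b] [c, d]
    = (\<Sum>xs\<in>?J. ?R [a, b] xs * mat_mult ?A ?J (leg ?A ?T 1) (leg ?A ?T 2) xs [c, d])"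
    using c d by (intro mat_mult_free_algebra R_closed closed) (auto simp: J)
  also have "\<dots> = (\<Sum>p\<in>{1..n}. \<Sum>q\<in>{1..n}.
      (if p = a \<and> q = b then free_scale (exch_wt r s a b) (t_word [p, q] [c, d]) else 0)
      + (if p = b \<and> q = a then free_scale (if b < a then s - r else 0) (t_word [p, q] [c, d]) else 0))"
    unfolding sum_tuples_2 R
  proof (intro sum.cong refl)
    fix p q assume pq: "p \<in> {1..n}" "q \<in> {1..n}"
    show "free_scale (R_mat n r s [a, b] [p, q]) 1
        * mat_mult ?A ?J (leg ?A ?T 1) (leg ?A ?T 2) [p, q] [c, d]
      = (if p = a \<and> q = b then free_scale (exch_wt r s a b) (t_word [p, q] [c, d]) else 0)
      + (if p = b \<and> q = a then free_scale (if b < a then s - r else 0) (t_word [p, q] [c, d]) else 0)"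
      unfolding T12[OF pq c d] R_mat_entries[OF a b] free_scale_simps(4) mult_1_left
      unfolding free_scale_simps(1)
      by (intro arg_cong2[where f = "(+)"]) (auto simp: free_scale_simps(2))
  qed
  also have "\<dots> = free_scale (exch_wt r s a b) (t_word [a, b] [c, d])
     + free_scale (if b < a then s - r else 0) (t_word [b, a] [c, d])"
    unfolding sum.distrib using a b by (simp add: sum_sum_delta)
  finally have lhs: "mat_mult ?A ?J ?R (mat_mult ?A ?J (leg ?A ?T 1) (leg ?A ?T 2)) [a, b] [c, d]
    = free_scale (exch_wt r s a b) (t_word [a, b] [c, d])
     + free_scale (if b < a then s - r else 0) (t_word [b, a] [c, d])" .
  have "mat_mult ?A ?J (mat_mult ?A ?J (leg ?A ?T 2) (leg ?A ?T 1)) ?R [a, b] [c, d]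
    = (\<Sum>xs\<in>?J. mat_mult ?A ?J (leg ?A ?T 2) (leg ?A ?T 1) [a, b] xs * ?R xs [c, d])"
    using a b by (intro mat_mult_free_algebra R_closed closed) (auto simp: J)
  also have "\<dots> = (\<Sum>p\<in>{1..n}. \<Sum>q\<in>{1..n}.
      (if p = c \<and> q = d then free_scale (exch_wt r s c d) (t_word [b, a] [q, p]) else 0)
      + (if p = d \<and> q = c then free_scale (if c < d then s - r else 0) (t_word [b, a] [q, p]) else 0))"
    unfolding sum_tuples_2 R
  proof (intro sum.cong refl)
    fix p q assume pq: "p \<in> {1..n}" "q \<in> {1..n}"
    show "mat_mult ?A ?J (leg ?A ?T 2) (leg ?A ?T 1) [a, b] [p, q]
        * free_scale (R_mat n r s [p, q] [c, d]) 1
      = (if p = c \<and> q = d then free_scale (exch_wt r s c d) (t_word [b, a] [q, p]) else 0)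
      + (if p = d \<and> q = c then free_scale (if c < d then s - r else 0) (t_word [b, a] [q, p]) else 0)"
      unfolding T21[OF a b pq] R_mat_entries[OF pq] t_word_mult_scale mult_1_right
      unfolding free_scale_simps(1)
      by (intro arg_cong2[where f = "(+)"]) (auto simp: free_scale_simps(2))
  qed
  also have "\<dots> = free_scale (exch_wt r s c d) (t_word [b, a] [d, c])
     + free_scale (if c < d then s - r else 0) (t_word [b, a] [c, d])"
    unfolding sum.distrib using c d by (simp add: sum_sum_delta)
  finally have "rtt_relator r s a b c d =
    mat_mult ?A ?J ?R (mat_mult ?A ?J (leg ?A ?T 1) (leg ?A ?T 2)) [a, b] [c, d]
    - mat_mult ?A ?J (mat_mult ?A ?J (leg ?A ?T 2) (leg ?A ?T 1)) ?R [a, b] [c, d]"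
    by (simp only: rtt_relator_def lhs)
  moreover have "[a, b] \<in> ?J" "[c, d] \<in> ?J" using a b c d by (simp_all only: J)
  ultimately show ?thesis
    unfolding RTT_relators_def Let_def mem_Collect_eq by (intro exI conjI)
qed

section \<open>Quasi-centrality modulo the defining ideal\<close>

abbreviation gl_ideal :: "nat \<Rightarrow> complex \<Rightarrow> complex \<Rightarrow> gl_gen free set" where
  "gl_ideal n r s \<equiv> Idl\<^bsub>free_algebra (gl_gens n)\<^esub> gl_relators n r s"

lemma t_word_sandwich:
  assumes "length u = length u'" "length v = length v'" "length x = length y"
  shows "t_word u u' * free_scale c (t_word x y) * t_word v v' = free_scale c (t_word (u @ x @ v) (u' @ y @ v'))"
  using assms by (simp add: t_word_mult_scale free_scale_simps t_word_append mult.assoc)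

text \<open>
  Multiplying a relator by monomials on both sides stays in the ideal, which yields the RTT relation
  at any adjacent pair of positions of a longer monomial.
\<close>

lemma RTT_form_functional:
  assumes lin: "Vector_Spaces.linear free_scale (*) \<phi>" and vanish: "\<And>x. x \<in> gl_ideal n r s \<Longrightarrow> \<phi> x = 0"
  shows "RTT_form n m r s (\<lambda>xs ys. \<phi> (t_word xs ys))"
  unfolding RTT_form_def
proof (intro allI impI)
  fix u a b v u' c d v'
  assume len: "length u = length u'" and xs: "u @ a # b # v \<in> tuples n m" and ys: "u' @ c # d # v' \<in> tuples n m"
  interpret \<phi>: Vector_Spaces.linear free_scale "(*)" \<phi> by (rule lin)
  interpret I: ideal "gl_ideal n r s" "free_algebra (gl_gens n)" by (rule ideal_gl_relators)
  have lenv: "length v = length v'" using len xs ys by (auto simp: tuples_def)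
  have "rtt_relator r s a b c d \<in> gl_relators n r s"
    unfolding gl_relators_def using xs ys by (intro UnI1 rtt_relator_mem) (auto simp: tuples_def)
  then have "rtt_relator r s a b c d \<in> gl_ideal n r s"
    using ring.genideal_self[OF ring_free_algebra gl_relators_closed] by blast
  moreover have "t_word u u' \<in> carrier (free_algebra (gl_gens n))" "t_word v v' \<in> carrier (free_algebra (gl_gens n))"
    using xs ys by (auto simp: tuples_def intro!: t_word_carrier)
  ultimately have "t_word u u' * rtt_relator r s a b c d * t_word v v' \<in> gl_ideal n r s"
    using I.I_l_closed I.I_r_closed by (simp only: free_algebra_operations)
  then have "\<phi> (t_word u u' * rtt_relator r s a b c d * t_word v v') = 0" by (rule vanish)
  then show "exch_wt r s a b * \<phi> (t_word (u @ a # b # v) (u' @ c # d # v'))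
       + (if b < a then (s - r) * \<phi> (t_word (u @ b # a # v) (u' @ c # d # v')) else 0)
     = exch_wt r s c d * \<phi> (t_word (u @ b # a # v) (u' @ d # c # v'))
       + (if c < d then (s - r) * \<phi> (t_word (u @ b # a # v) (u' @ c # d # v')) else 0)"
    unfolding rtt_relator_def
    by (simp only: right_diff_distrib left_diff_distrib distrib_left distrib_right
        t_word_sandwich[OF len lenv] list.size \<phi>.diff \<phi>.add \<phi>.scale append_Cons append_Nil)
      (simp add: left_diff_distrib split: if_splits)
qed

definition qdet_rep :: "nat \<Rightarrow> complex \<Rightarrow> complex \<Rightarrow> gl_gen free" where
  "qdet_rep n r s = (\<Sum>xs\<in>tuples n n. \<Sum>ys\<in>tuples n n.
     free_scale (eps_bra n r s xs * eps_ket n r ys) (t_word xs ys))"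

text \<open>
  The coefficients of \<open>|\<epsilon>\<rangle>\<close> are collected outside, so that the inner sum is the one compared in
  \<open>skew_contraction_commutes\<close> for each column word \<open>ys\<close>.
\<close>

lemma functional_qdet_mult:
  assumes lin: "Vector_Spaces.linear free_scale (*) \<phi>"
  shows "\<phi> (qdet_rep n r s * t_word [k] [l]) = (\<Sum>ys\<in>tuples n n. eps_ket n r ys / rs_fact r s n *
      (\<Sum>xs\<in>tuples n n. skew s xs * \<phi> (t_word (xs @ [k]) (ys @ [l]))))"
    and "\<phi> (t_word [k] [l] * qdet_rep n r s) = (\<Sum>ys\<in>tuples n n. eps_ket n r ys / rs_fact r s n *
      (\<Sum>xs\<in>tuples n n. skew s xs * \<phi> (t_word (k # xs) (l # ys))))"
proof -
  interpret \<phi>: Vector_Spaces.linear free_scale "(*)" \<phi> by (rule lin)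
  have scaled: "(\<Sum>ys\<in>tuples n n. \<Sum>xs\<in>tuples n n. eps_bra n r s xs * eps_ket n r ys * f xs ys)
    = (\<Sum>ys\<in>tuples n n. eps_ket n r ys / rs_fact r s n * (\<Sum>xs\<in>tuples n n. skew s xs * f xs ys))" for f
    unfolding sum_distrib_left
  proof (intro sum.cong refl)
    fix xs ys assume "xs \<in> tuples n n"
    from eps_bra_eq_skew[OF this, of r s]
    show "eps_bra n r s xs * eps_ket n r ys * f xs ys = eps_ket n r ys / rs_fact r s n * (skew s xs * f xs ys)"
      by simp
  qed
  have "\<phi> (qdet_rep n r s * t_word [k] [l]) = (\<Sum>xs\<in>tuples n n. \<Sum>ys\<in>tuples n n.
      eps_bra n r s xs * eps_ket n r ys * \<phi> (t_word (xs @ [k]) (ys @ [l])))"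
    unfolding qdet_rep_def sum_distrib_right free_scale_simps(4) \<phi>.sum \<phi>.scale
  proof (intro sum.cong refl arg_cong2[where f = "(*)"] arg_cong[where f = \<phi>])
    fix xs ys assume "xs \<in> tuples n n" "ys \<in> tuples n n"
    then have "length xs = length ys" by (simp add: tuples_def)
    then show "t_word xs ys * t_word [k] [l] = t_word (xs @ [k]) (ys @ [l])"
      by (simp only: t_word_append)
  qed
  also have "\<dots> = (\<Sum>ys\<in>tuples n n. \<Sum>xs\<in>tuples n n.
      eps_bra n r s xs * eps_ket n r ys * \<phi> (t_word (xs @ [k]) (ys @ [l])))"
    by (rule sum.swap)
  finally show "\<phi> (qdet_rep n r s * t_word [k] [l]) = (\<Sum>ys\<in>tuples n n. eps_ket n r ys / rs_fact r s n *
      (\<Sum>xs\<in>tuples n n. skew s xs * \<phi> (t_word (xs @ [k]) (ys @ [l]))))"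
    by (simp only: scaled)
  have "\<phi> (t_word [k] [l] * qdet_rep n r s) = (\<Sum>xs\<in>tuples n n. \<Sum>ys\<in>tuples n n.
      eps_bra n r s xs * eps_ket n r ys * \<phi> (t_word (k # xs) (l # ys)))"
    unfolding qdet_rep_def sum_distrib_left t_word_mult_scale \<phi>.sum \<phi>.scale
  proof (intro sum.cong refl arg_cong2[where f = "(*)"] arg_cong[where f = \<phi>])
    show "t_word [k] [l] * t_word xs ys = t_word (k # xs) (l # ys)" for xs ys
      using t_word_append[of "[k]" "[l]" xs ys] by (simp only: list.size append_Cons append_Nil)
  qed
  also have "\<dots> = (\<Sum>ys\<in>tuples n n. \<Sum>xs\<in>tuples n n.
      eps_bra n r s xs * eps_ket n r ys * \<phi> (t_word (k # xs) (l # ys)))"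
    by (rule sum.swap)
  finally show "\<phi> (t_word [k] [l] * qdet_rep n r s) = (\<Sum>ys\<in>tuples n n. eps_ket n r ys / rs_fact r s n *
      (\<Sum>xs\<in>tuples n n. skew s xs * \<phi> (t_word (k # xs) (l # ys))))"
    by (simp only: scaled)
qed

lemma qdet_rep_commutes_mod_ideal:
  assumes "r \<noteq> 0" "s \<noteq> 0" "r + s \<noteq> 0" "k \<in> {1..n}" "l \<in> {1..n}"
  shows "qdet_rep n r s * t_word [k] [l]
    - free_scale ((r * s) powi (int k - int l)) (t_word [k] [l] * qdet_rep n r s) \<in> gl_ideal n r s"
proof (rule mem_ideal_by_functionals[OF ideal_gl_relators])
  fix \<phi> :: "gl_gen free \<Rightarrow> complex"
  assume lin: "Vector_Spaces.linear free_scale (*) \<phi>" and vanish: "\<And>x. x \<in> gl_ideal n r s \<Longrightarrow> \<phi> x = 0"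
  interpret \<phi>: Vector_Spaces.linear free_scale "(*)" \<phi> by (rule lin)
  have rs: "r * s \<noteq> 0" using assms by simp
  have pw: "(r * s) powi (int k - int l) = (r * s) ^ (k - 1) / (r * s) ^ (l - 1)"
  proof -
    have "(r * s) powi (int a - int b) = (r * s) ^ a / (r * s) ^ b" for a b
      using rs by (simp add: power_int_diff)
    moreover have "int k - int l = int (k - 1) - int (l - 1)" using assms(4,5) by auto
    ultimately show ?thesis by (simp only:)
  qed
  have quotient: "A = y / x * B" if "x * A = y * B" "x \<noteq> 0" for A B x y :: complex
    using that by (simp add: field_simps)
  have skew_sums: "(\<Sum>xs\<in>tuples n n. skew s xs * \<phi> (t_word (xs @ [k]) (ys @ [l])))
    = (r * s) powi (int k - int l) * (\<Sum>xs\<in>tuples n n. skew s xs * \<phi> (t_word (k # xs) (l # ys)))"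
    if "ys \<in> tuples n n" for ys
    unfolding pw
  proof (rule quotient)
    show "(r * s) ^ (l - 1) \<noteq> 0" using rs by simp
  qed (rule skew_contraction_commutes[OF assms(1-3) RTT_form_functional[OF lin vanish] assms(4,5) that])
  have "\<phi> (qdet_rep n r s * t_word [k] [l])
    = (r * s) powi (int k - int l) * \<phi> (t_word [k] [l] * qdet_rep n r s)"
    unfolding functional_qdet_mult[OF lin]
    unfolding sum_distrib_left[of "(r * s) powi (int k - int l)"]
  proof (rule sum.cong[OF refl])
    fix ys assume "ys \<in> tuples n n"
    from skew_sums[OF this]
    show "eps_ket n r ys / rs_fact r s n * (\<Sum>xs\<in>tuples n n. skew s xs * \<phi> (t_word (xs @ [k]) (ys @ [l])))
      = (r * s) powi (int k - int l) * (eps_ket n r ys / rs_fact r s n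
        * (\<Sum>xs\<in>tuples n n. skew s xs * \<phi> (t_word (k # xs) (l # ys))))"
      by (simp only: mult.left_commute)
  qed
  then show "\<phi> (qdet_rep n r s * t_word [k] [l]
    - free_scale ((r * s) powi (int k - int l)) (t_word [k] [l] * qdet_rep n r s)) = 0"
    by (simp only: \<phi>.diff \<phi>.scale diff_self)
qed

lemma qdet_rep_closed: "qdet_rep n r s \<in> carrier (free_algebra (gl_gens n))"
  unfolding qdet_rep_def
  by (intro free_algebra_sum_closed free_algebra_scale_closed t_word_carrier) (auto simp: tuples_def)

section \<open>The quotient \<open>Fun(GL_{r,s}(n))\<close>\<close>

abbreviation gl_class :: "nat \<Rightarrow> complex \<Rightarrow> complex \<Rightarrow> gl_gen free \<Rightarrow> gl_gen free set" where
  "gl_class n r s p \<equiv> gl_ideal n r s +>\<^bsub>free_algebra (gl_gens n)\<^esub> p"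

lemma gl_class_hom: "ring_hom_ring (free_algebra (gl_gens n)) (Fun_GL n r s) (gl_class n r s)"
proof (rule ring_hom_ringI2[OF ring_free_algebra ring_Fun_GL])
  show "gl_class n r s \<in> ring_hom (free_algebra (gl_gens n)) (Fun_GL n r s)"
    using ideal.rcos_ring_hom[OF ideal_gl_relators, of n r s]
    by (simp add: ring_hom_def Fun_GL_def presented_algebra_def quot_algebra_def ring.defs)
qed

lemma gl_class_scale:
  "p \<in> carrier (free_algebra (gl_gens n)) \<Longrightarrow>
    c \<odot>\<^bsub>Fun_GL n r s\<^esub> gl_class n r s p = gl_class n r s (free_scale c p)"
  by (simp add: Fun_GL_def presented_algebra_def smult_coset[OF ideal_gl_relators] free_algebra_operations)

lemma gl_class_sum:
  assumes "\<And>x. x \<in> J \<Longrightarrow> f x \<in> carrier (free_algebra (gl_gens n))"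
  shows "finsum (Fun_GL n r s) (\<lambda>x. gl_class n r s (f x)) J = gl_class n r s (sum f J)"
proof -
  interpret ring_hom_ring "free_algebra (gl_gens n)" "Fun_GL n r s" "gl_class n r s" by (rule gl_class_hom)
  have "gl_class n r s (finsum (free_algebra (gl_gens n)) f J) = finsum (Fun_GL n r s) (gl_class n r s \<circ> f) J"
    using assms by (intro hom_finsum) auto
  then show ?thesis using assms by (simp add: finsum_free_algebra o_def)
qed

lemma gl_class_mult:
  assumes "p \<in> carrier (free_algebra (gl_gens n))" "q \<in> carrier (free_algebra (gl_gens n))"
  shows "gl_class n r s p \<otimes>\<^bsub>Fun_GL n r s\<^esub> gl_class n r s q = gl_class n r s (p * q)"
proof -
  interpret ring_hom_ring "free_algebra (gl_gens n)" "Fun_GL n r s" "gl_class n r s" by (rule gl_class_hom)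
  show ?thesis using hom_mult[OF assms] by (simp add: free_algebra_operations)
qed

lemma gl_class_one: "\<one>\<^bsub>Fun_GL n r s\<^esub> = gl_class n r s 1"
proof -
  interpret ring_hom_ring "free_algebra (gl_gens n)" "Fun_GL n r s" "gl_class n r s" by (rule gl_class_hom)
  show ?thesis using hom_one by (simp add: free_algebra_operations)
qed

lemma gl_class_zero: "\<zero>\<^bsub>Fun_GL n r s\<^esub> = gl_class n r s 0"
proof -
  interpret ring_hom_ring "free_algebra (gl_gens n)" "Fun_GL n r s" "gl_class n r s" by (rule gl_class_hom)
  show ?thesis using hom_zero by (simp add: free_algebra_operations)
qed

lemma gl_class_mat_mult:
  assumes "\<And>k. k \<in> J \<Longrightarrow> X i k \<in> carrier (free_algebra (gl_gens n))"
    and "\<And>k. k \<in> J \<Longrightarrow> Y k j \<in> carrier (free_algebra (gl_gens n))"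
    and "\<And>k. k \<in> J \<Longrightarrow> X' i k = gl_class n r s (X i k)" "\<And>k. k \<in> J \<Longrightarrow> Y' k j = gl_class n r s (Y k j)"
  shows "mat_mult (Fun_GL n r s) J X' Y' i j = gl_class n r s (\<Sum>k\<in>J. X i k * Y k j)"
proof -
  interpret F: ring "Fun_GL n r s" by (rule ring_Fun_GL)
  interpret ring_hom_ring "free_algebra (gl_gens n)" "Fun_GL n r s" "gl_class n r s" by (rule gl_class_hom)
  have "mat_mult (Fun_GL n r s) J X' Y' i j = finsum (Fun_GL n r s) (\<lambda>k. gl_class n r s (X i k * Y k j)) J"
    unfolding mat_mult_def
    using assms by (intro F.finsum_cong') (auto simp: gl_class_mult free_algebra_mult_closed intro!: hom_closed)
  also have "\<dots> = gl_class n r s (\<Sum>k\<in>J. X i k * Y k j)"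
    using assms by (intro gl_class_sum free_algebra_mult_closed)
  finally show ?thesis .
qed

lemma T_mat_eq_gl_class: "T_mat n r s i j = gl_class n r s (t_word [i] [j])"
  by (simp add: T_mat_def gen_class_def gen_elem_eq_t_word)

text \<open>
  The product of the last \<open>m - j\<close> legs acts as the identity on the first \<open>j\<close> tensor factors.
  In the induction step, the only intermediate word with a nonzero contribution is \<open>xs\<close> with
  the entry at \<open>j\<close> replaced by that of \<open>ys\<close>.
\<close>

lemma legs_prod_T_mat:
  assumes "j \<le> m" "xs \<in> tuples n m" "ys \<in> tuples n m"
  shows "foldr (\<lambda>k. mat_mult (Fun_GL n r s) (tuples n m) (leg (Fun_GL n r s) (T_mat n r s) k))
      [Suc j..<Suc m] (mat_one (Fun_GL n r s)) xs ys
    = gl_class n r s (if take j xs = take j ys then t_word (drop j xs) (drop j ys) else 0)"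
  using assms
proof (induction j arbitrary: xs ys rule: inc_induct)
  case base
  then show ?case
    by (simp add: mat_one_def tuples_def gl_class_one gl_class_zero t_word_Nil)
next
  case (step j)
  let ?F = "Fun_GL n r s" and ?J = "tuples n m"
  let ?X = "\<lambda>xs zs :: nat list. if \<forall>p<m. p \<noteq> j \<longrightarrow> xs ! p = zs ! p then t_word [xs ! j] [zs ! j] else 0"
  let ?Y = "\<lambda>zs ys. if take (Suc j) zs = take (Suc j) ys then t_word (drop (Suc j) zs) (drop (Suc j) ys) else 0"
  have set_nth: "zs ! p \<in> {1..n}" if "zs \<in> ?J" "p < m" for zs p
  proof -
    have "zs ! p \<in> set zs" using that by (simp add: tuples_def)
    then show ?thesis using that(1) unfolding tuples_def by blast
  qed
  have drop_sub: "set (drop i zs) \<subseteq> {1..n}" if "zs \<in> ?J" for zs i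
    using that set_drop_subset[of i zs] by (auto simp: tuples_def)
  have len: "length xs = m" "length ys = m" using step.prems by (simp_all add: tuples_def)
  have "foldr (\<lambda>k. mat_mult ?F ?J (leg ?F (T_mat n r s) k)) [Suc j..<Suc m] (mat_one ?F) xs ys
    = mat_mult ?F ?J (leg ?F (T_mat n r s) (Suc j))
        (foldr (\<lambda>k. mat_mult ?F ?J (leg ?F (T_mat n r s) k)) [Suc (Suc j)..<Suc m] (mat_one ?F)) xs ys"
    using step.hyps by (simp add: upt_conv_Cons del: upt_Suc)
  also have "\<dots> = gl_class n r s (\<Sum>zs\<in>?J. ?X xs zs * ?Y zs ys)"
  proof (rule gl_class_mat_mult)
    fix zs assume zs: "zs \<in> ?J"
    show "?X xs zs \<in> carrier (free_algebra (gl_gens n))"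
      using set_nth[OF step.prems(1) step.hyps(2)] set_nth[OF zs step.hyps(2)]
      by (simp add: t_word_carrier free_algebra_zero_one_closed)
    show "?Y zs ys \<in> carrier (free_algebra (gl_gens n))"
      using drop_sub[OF zs] drop_sub[OF step.prems(2)]
      by (simp add: t_word_carrier free_algebra_zero_one_closed)
    show "leg ?F (T_mat n r s) (Suc j) xs zs = gl_class n r s (?X xs zs)"
      by (auto simp: leg_def len T_mat_eq_gl_class gl_class_zero)
    show "foldr (\<lambda>k. mat_mult ?F ?J (leg ?F (T_mat n r s) k)) [Suc (Suc j)..<Suc m] (mat_one ?F) zs ys
      = gl_class n r s (?Y zs ys)"
      by (rule step.IH[OF zs step.prems(2)])
  qed
  also have "(\<Sum>zs\<in>?J. ?X xs zs * ?Y zs ys) = (\<Sum>zs\<in>?J. if zs = xs[j := ys ! j] then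
      (if take j xs = take j ys then t_word (drop j xs) (drop j ys) else 0) else 0)"
  proof (intro sum.cong refl)
    fix zs assume zs: "zs \<in> ?J"
    then have lenz: "length zs = m" by (simp add: tuples_def)
    have take_eq: "take i us = take i vs \<longleftrightarrow> (\<forall>p<i. us ! p = vs ! p)"
      if "i \<le> m" "length us = m" "length vs = m" for i and us vs :: "nat list"
      using that by (auto simp: list_eq_iff_nth_eq)
    have iff: "(\<forall>p<m. p \<noteq> j \<longrightarrow> xs ! p = zs ! p) \<and> take (Suc j) zs = take (Suc j) ys
      \<longleftrightarrow> zs = xs[j := ys ! j] \<and> take j xs = take j ys" (is "?L \<longleftrightarrow> ?R")
    proof
      assume L: ?L
      then have L2: "\<forall>p<Suc j. zs ! p = ys ! p"
        using take_eq[of "Suc j" zs ys] step.hyps(2) lenz len by simp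
      have "zs = xs[j := ys ! j]"
      proof (rule nth_equalityI)
        fix p assume "p < length zs"
        then show "zs ! p = xs[j := ys ! j] ! p"
          using L L2 by (cases "p = j") (simp_all add: lenz len)
      qed (simp add: lenz len)
      moreover have "take j xs = take j ys"
        using L L2 step.hyps(2) take_eq[of j xs ys] len by simp
      ultimately show ?R by simp
    next
      assume R: ?R
      then have "\<forall>p<j. xs ! p = ys ! p" using take_eq[of j xs ys] step.hyps(2) len by simp
      with R show ?L
        using take_eq[of "Suc j" zs ys] step.hyps(2) lenz len by (auto simp: nth_list_update less_Suc_eq)
    qed
    have prod: "t_word [xs ! j] [zs ! j] * t_word (drop (Suc j) zs) (drop (Suc j) ys)
      = t_word (drop j xs) (drop j ys)" if "zs = xs[j := ys ! j]"
    proof -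
      have "t_word (drop j xs) (drop j ys)
        = t_word ([xs ! j] @ drop (Suc j) xs) ([ys ! j] @ drop (Suc j) ys)"
        using step.hyps(2) len by (simp add: Cons_nth_drop_Suc)
      also have "\<dots> = t_word [xs ! j] [ys ! j] * t_word (drop (Suc j) xs) (drop (Suc j) ys)"
        by (rule t_word_append) simp
      finally show ?thesis using that step.hyps(2) len by simp
    qed
    have "?X xs zs * ?Y zs ys = (if (\<forall>p<m. p \<noteq> j \<longrightarrow> xs ! p = zs ! p) \<and> take (Suc j) zs = take (Suc j) ys
        then t_word [xs ! j] [zs ! j] * t_word (drop (Suc j) zs) (drop (Suc j) ys) else 0)"
      by auto
    also have "\<dots> = (if zs = xs[j := ys ! j] then
      (if take j xs = take j ys then t_word (drop j xs) (drop j ys) else 0) else 0)"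
      unfolding iff using prod by simp
    finally show "?X xs zs * ?Y zs ys = (if zs = xs[j := ys ! j] then
      (if take j xs = take j ys then t_word (drop j xs) (drop j ys) else 0) else 0)" .
  qed
  also have "\<dots> = (if take j xs = take j ys then t_word (drop j xs) (drop j ys) else 0)"
  proof -
    have "xs[j := ys ! j] \<in> ?J"
      using step.prems(1) set_nth[OF step.prems(2) step.hyps(2)] set_update_subset_insert[of xs j "ys ! j"]
      by (auto simp: tuples_def)
    then show ?thesis by (simp only: sum.delta finite_tuples if_True)
  qed
  finally show ?case .
qed

lemma qdet_eq_gl_class: "qdet n r s = gl_class n r s (qdet_rep n r s)"
proof -
  interpret F: ring "Fun_GL n r s" by (rule ring_Fun_GL)
  interpret ring_hom_ring "free_algebra (gl_gens n)" "Fun_GL n r s" "gl_class n r s" by (rule gl_class_hom)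
  have closed: "t_word xs ys \<in> carrier (free_algebra (gl_gens n))"
    if "xs \<in> tuples n n" "ys \<in> tuples n n" for xs ys
    using that by (intro t_word_carrier) (auto simp: tuples_def)
  let ?c = "\<lambda>xs ys. eps_bra n r s xs * eps_ket n r ys"
  have entry: "?c xs ys \<odot>\<^bsub>Fun_GL n r s\<^esub> legs_prod (Fun_GL n r s) n n (T_mat n r s) xs ys
    = gl_class n r s (free_scale (?c xs ys) (t_word xs ys))"
    if "xs \<in> tuples n n" "ys \<in> tuples n n" for xs ys
    using legs_prod_T_mat[of 0 n xs n ys r s] that closed[OF that]
    by (simp add: legs_prod_def gl_class_scale del: upt_Suc)
  have row: "finsum (Fun_GL n r s) (\<lambda>ys. ?c xs ys \<odot>\<^bsub>Fun_GL n r s\<^esub> legs_prod (Fun_GL n r s) n n (T_mat n r s) xs ys) (tuples n n)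
    = gl_class n r s (\<Sum>ys\<in>tuples n n. free_scale (?c xs ys) (t_word xs ys))"
    if "xs \<in> tuples n n" for xs
  proof -
    have "finsum (Fun_GL n r s) (\<lambda>ys. ?c xs ys \<odot>\<^bsub>Fun_GL n r s\<^esub> legs_prod (Fun_GL n r s) n n (T_mat n r s) xs ys) (tuples n n)
      = finsum (Fun_GL n r s) (\<lambda>ys. gl_class n r s (free_scale (?c xs ys) (t_word xs ys))) (tuples n n)"
      using that entry by (intro F.finsum_cong') (auto intro!: hom_closed free_algebra_scale_closed closed)
    also have "\<dots> = gl_class n r s (\<Sum>ys\<in>tuples n n. free_scale (?c xs ys) (t_word xs ys))"
      using that by (intro gl_class_sum free_algebra_scale_closed closed)
    finally show ?thesis .
  qed
  have "qdet n r s = finsum (Fun_GL n r s)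
      (\<lambda>xs. gl_class n r s (\<Sum>ys\<in>tuples n n. free_scale (?c xs ys) (t_word xs ys))) (tuples n n)"
    unfolding qdet_def Let_def
    using row by (intro F.finsum_cong') (auto intro!: hom_closed free_algebra_sum_closed free_algebra_scale_closed closed)
  also have "\<dots> = gl_class n r s (qdet_rep n r s)"
    unfolding qdet_rep_def by (intro gl_class_sum free_algebra_sum_closed free_algebra_scale_closed closed)
  finally show ?thesis .
qed

lemma gl_class_eqI:
  assumes "p \<in> carrier (free_algebra (gl_gens n))" "q \<in> carrier (free_algebra (gl_gens n))"
    and "p - q \<in> gl_ideal n r s"
  shows "gl_class n r s p = gl_class n r s q"
proof -
  interpret A: ring "free_algebra (gl_gens n)" by (rule ring_free_algebra)
  have "- q \<in> carrier (free_algebra (gl_gens n))"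
    using free_algebra_diff[OF free_algebra_zero_one_closed(1) assms(2)] by simp
  then have "\<ominus>\<^bsub>free_algebra (gl_gens n)\<^esub> q = - q"
    using assms(2) by (intro A.minus_equality) (simp_all add: free_algebra_operations)
  then have "p \<ominus>\<^bsub>free_algebra (gl_gens n)\<^esub> q \<in> gl_ideal n r s"
    using assms(3) by (simp add: a_minus_def free_algebra_operations)
  then show ?thesis
    using A.quotient_eq_iff_same_a_r_cos[OF ideal_gl_relators assms(1,2)] by simp
qed

lemma qdet_T_mat_commute:
  assumes "r \<noteq> 0" "s \<noteq> 0" "r + s \<noteq> 0" "i \<in> {1..n}" "j \<in> {1..n}"
  shows "qdet n r s \<otimes>\<^bsub>Fun_GL n r s\<^esub> T_mat n r s i j
    = ((r * s) powi (int i - int j)) \<odot>\<^bsub>Fun_GL n r s\<^esub> (T_mat n r s i j \<otimes>\<^bsub>Fun_GL n r s\<^esub> qdet n r s)"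
proof -
  have T: "t_word [i] [j] \<in> carrier (free_algebra (gl_gens n))"
    using assms by (intro t_word_carrier) auto
  have "gl_class n r s (qdet_rep n r s * t_word [i] [j])
    = gl_class n r s (free_scale ((r * s) powi (int i - int j)) (t_word [i] [j] * qdet_rep n r s))"
    by (intro gl_class_eqI free_algebra_scale_closed free_algebra_mult_closed qdet_rep_closed T
        qdet_rep_commutes_mod_ideal assms)
  then show ?thesis
    by (simp add: qdet_eq_gl_class T_mat_eq_gl_class gl_class_mult gl_class_scale
        free_algebra_mult_closed qdet_rep_closed T)
qed

lemma scalar_mat_Fun_GL: "scalar_mat (Fun_GL n r s) X i j = gl_class n r s (free_scale (X i j) 1)"
  by (simp add: scalar_mat_def gl_class_one gl_class_scale free_algebra_zero_one_closed)

lemma M_mat_conjugation: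
  assumes "r \<noteq> 0" "s \<noteq> 0" "i \<in> {1..n}" "j \<in> {1..n}"
  shows "mat_mult (Fun_GL n r s) {1..n}
       (mat_mult (Fun_GL n r s) {1..n}
          (scalar_mat (Fun_GL n r s) (mat_inv {1..n} (M_mat n r s))) (T_mat n r s))
       (scalar_mat (Fun_GL n r s) (M_mat n r s)) i j
     = ((r * s) powi (int i - int j)) \<odot>\<^bsub>Fun_GL n r s\<^esub> T_mat n r s i j"
proof -
  let ?F = "Fun_GL n r s" and ?d = "\<lambda>k. (r * s) ^ (n - k)"
  have T: "t_word [k] [l] \<in> carrier (free_algebra (gl_gens n))" if "k \<in> {1..n}" "l \<in> {1..n}" for k l
    using that by (intro t_word_carrier) auto
  have inv: "mat_inv {1..n} (M_mat n r s) = (\<lambda>k l. if k \<in> {1..n} \<and> k = l then inverse (?d k) else 0)"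
    unfolding M_mat_def using assms by (intro mat_inv_diag) auto
  have left: "mat_mult ?F {1..n} (scalar_mat ?F (mat_inv {1..n} (M_mat n r s))) (T_mat n r s) i k
    = gl_class n r s (free_scale (inverse (?d i)) (t_word [i] [k]))" if k: "k \<in> {1..n}" for k
  proof -
    have "mat_mult ?F {1..n} (scalar_mat ?F (mat_inv {1..n} (M_mat n r s))) (T_mat n r s) i k
      = gl_class n r s (\<Sum>x\<in>{1..n}. free_scale (mat_inv {1..n} (M_mat n r s) i x) 1 * t_word [x] [k])"
      by (intro gl_class_mat_mult scalar_mat_Fun_GL T_mat_eq_gl_class free_algebra_scale_closed
          free_algebra_zero_one_closed T k)
    also have "(\<Sum>x\<in>{1..n}. free_scale (mat_inv {1..n} (M_mat n r s) i x) 1 * t_word [x] [k])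
      = (\<Sum>x\<in>{1..n}. if x = i then free_scale (inverse (?d i)) (t_word [i] [k]) else 0)"
      unfolding inv by (intro sum.cong refl) (use assms in \<open>simp add: free_scale_simps\<close>)
    also have "\<dots> = free_scale (inverse (?d i)) (t_word [i] [k])"
      using assms(3) by (simp only: sum.delta finite_atLeastAtMost if_True)
    finally show ?thesis .
  qed
  have "mat_mult ?F {1..n}
       (mat_mult ?F {1..n} (scalar_mat ?F (mat_inv {1..n} (M_mat n r s))) (T_mat n r s))
       (scalar_mat ?F (M_mat n r s)) i j
    = gl_class n r s (\<Sum>k\<in>{1..n}. free_scale (inverse (?d i)) (t_word [i] [k]) * free_scale (M_mat n r s k j) 1)"
    by (intro gl_class_mat_mult left scalar_mat_Fun_GL free_algebra_scale_closed
        free_algebra_zero_one_closed T assms)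
  also have "(\<Sum>k\<in>{1..n}. free_scale (inverse (?d i)) (t_word [i] [k]) * free_scale (M_mat n r s k j) 1)
    = (\<Sum>k\<in>{1..n}. if k = j then free_scale (inverse (?d i) * ?d j) (t_word [i] [j]) else 0)"
    by (intro sum.cong refl) (simp add: M_mat_def free_scale_simps t_word_mult_scale)
  also have "\<dots> = free_scale (inverse (?d i) * ?d j) (t_word [i] [j])"
    using assms(4) by (simp only: sum.delta finite_atLeastAtMost if_True)
  also have "inverse (?d i) * ?d j = (r * s) powi (int i - int j)"
  proof -
    have "(r * s) powi (int a - int b) = (r * s) ^ a / (r * s) ^ b" for a b
      using assms by (simp add: power_int_diff)
    moreover have "int i - int j = int (n - j) - int (n - i)" using assms(3,4) by auto
    ultimately show ?thesis by (simp only: divide_inverse mult.commute)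
  qed
  moreover have "((r * s) powi (int i - int j)) \<odot>\<^bsub>?F\<^esub> T_mat n r s i j
      = gl_class n r s (free_scale ((r * s) powi (int i - int j)) (t_word [i] [j]))"
    using T[OF assms(3,4)] by (simp add: T_mat_eq_gl_class gl_class_scale)
  ultimately show ?thesis by (simp only:)
qed

theorem theorem2p10:
  fixes n :: nat and r s :: complex
  assumes "n \<ge> 2" and "r \<noteq> 0" and "s \<noteq> 0" and "r \<noteq> s"
    and "\<forall>k\<in>{1..n}. rs_int r s k \<noteq> 0"
  shows "quasi_central (Fun_GL n r s) {T_mat n r s i j | i j. i \<in> {1..n} \<and> j \<in> {1..n}} (qdet n r s)
    \<and> (\<forall>i\<in>{1..n}. \<forall>j\<in>{1..n}.
        qdet n r s \<otimes>\<^bsub>Fun_GL n r s\<^esub> T_mat n r s i j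
        = mat_mult (Fun_GL n r s) {1..n}
            (mat_mult (Fun_GL n r s) {1..n}
               (scalar_mat (Fun_GL n r s) (mat_inv {1..n} (M_mat n r s))) (T_mat n r s))
            (scalar_mat (Fun_GL n r s) (M_mat n r s)) i j
          \<otimes>\<^bsub>Fun_GL n r s\<^esub> qdet n r s)
    \<and> (\<forall>i\<in>{1..n}. \<forall>j\<in>{1..n}.
        qdet n r s \<otimes>\<^bsub>Fun_GL n r s\<^esub> T_mat n r s i j
        = ((r * s) powi (int i - int j)) \<odot>\<^bsub>Fun_GL n r s\<^esub>
            (T_mat n r s i j \<otimes>\<^bsub>Fun_GL n r s\<^esub> qdet n r s))"
proof -
  (* the nonvanishing of [2]_{r,s} = r + s *)
  have "rs_int r s 2 \<noteq> 0" using assms(1,5) by simp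
  then have "r + s \<noteq> 0"
    by (auto simp: rs_int_def power2_eq_square add_eq_0_iff)
  note commute = qdet_T_mat_commute[OF assms(2,3) this]
  have quasi: "quasi_central (Fun_GL n r s) {T_mat n r s i j | i j. i \<in> {1..n} \<and> j \<in> {1..n}} (qdet n r s)"
    unfolding quasi_central_def
  proof
    fix x assume "x \<in> {T_mat n r s i j | i j. i \<in> {1..n} \<and> j \<in> {1..n}}"
    then obtain i j where x: "x = T_mat n r s i j" "i \<in> {1..n}" "j \<in> {1..n}" by blast
    have "(r * s) powi (int i - int j) \<noteq> 0" using assms(2,3) by simp
    with commute[OF x(2,3)] show "\<exists>c. c \<noteq> 0 \<and> qdet n r s \<otimes>\<^bsub>Fun_GL n r s\<^esub> x
        = c \<odot>\<^bsub>Fun_GL n r s\<^esub> (x \<otimes>\<^bsub>Fun_GL n r s\<^esub> qdet n r s)"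
      unfolding x(1) by blast
  qed
  have conj: "qdet n r s \<otimes>\<^bsub>Fun_GL n r s\<^esub> T_mat n r s i j
      = mat_mult (Fun_GL n r s) {1..n}
          (mat_mult (Fun_GL n r s) {1..n}
             (scalar_mat (Fun_GL n r s) (mat_inv {1..n} (M_mat n r s))) (T_mat n r s))
          (scalar_mat (Fun_GL n r s) (M_mat n r s)) i j
        \<otimes>\<^bsub>Fun_GL n r s\<^esub> qdet n r s" if "i \<in> {1..n}" "j \<in> {1..n}" for i j
  proof -
    have T: "t_word [i] [j] \<in> carrier (free_algebra (gl_gens n))"
      using that by (intro t_word_carrier) auto
    show ?thesis
      unfolding commute[OF that] M_mat_conjugation[OF assms(2,3) that]
      by (simp add: qdet_eq_gl_class T_mat_eq_gl_class gl_class_mult gl_class_scale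
          free_algebra_mult_closed free_algebra_scale_closed qdet_rep_closed T free_scale_simps)
  qed
  from quasi conj commute show ?thesis by blast
qed

end
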